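(* Let $l,\alpha,k>0$. Let $\mathbf{M}\in\mathrm{wp}(4,8,\mathbb{C})$ and suppose $\lambda\in\mathbb{C}\setminus\operatorname{Spec}\mathcal{K}_{\mathbf{Q}}$. Then $\lambda\in\operatorname{Spec}\mathcal{K}_{\mathbf{M}}$ if and only if $\lambda\neq0$ and $\det\left\{\mathbf{G}_{\mathbf{M}}\mathbf{Y}_\lambda(l)-\mathbf{I}\right\}=0$.
   Context: Fix $l,\alpha,k>0$. $\mathrm{gl}(m,n,\mathbb{C})$ is the set of complex $m\times n$ matrices, $\mathrm{gl}(n,\mathbb{C})=\mathrm{gl}(n,n,\mathbb{C})$; $\mathbf{I}$ is the $4\times4$ identity matrix; $L^2[-l,l]$ is the Hilbert space of complex-valued square-integrable functions. $\operatorname{Spec}$ of an operator denotes its set of (complex) eigenvalues. Matrices. $\omega_j=e^{\sqrt{-1}\,\frac{\pi}{4}(2j-1)}$ ($j\in\mathbb{Z}$), $\mathbf{\Omega}=\mathrm{diag}(\omega_1,\omega_2,\omega_3,\omega_4)$, $\mathcal{E}=\mathrm{diag}(1,-1,-1,1)$, and $\mathbf{L}^2=\begin{pmatrix}0&0&1&0\\0&0&0&1\\1&0&0&0\\0&1&0&0\end{pmatrix}$. Let $\mathbf{y}(x)=(e^{\omega_1\alpha x},e^{\omega_2\alpha x},e^{\omega_3\alpha x},e^{\omega_4\alpha x})^T$ and $\mathbf{W}(x)=\left((\omega_q\alpha)^{p-1}e^{\omega_q\alpha x}\right)_{1\le p,q\le 4}$ (row index $p$, column index $q$), which is invertible for every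 $x$. Well-posedness. Write $\mathbf{M}=(\mathbf{M}^-\ \mathbf{M}^+)\in\mathrm{gl}(4,8,\mathbb{C})$ with $\mathbf{M}^\pm\in\mathrm{gl}(4,\mathbb{C})$. For $u\in C^3[-l,l]$, $\mathcal{B}[u]=(u(-l),u'(-l),u''(-l),u'''(-l),u(l),u'(l),u''(l),u'''(l))^T$. $\mathbf{M}$ is well-posed if $u=0$ is the only solution of $u^{(4)}+\alpha^4u=0$ on $[-l,l]$ with $\mathbf{M}\cdot\mathcal{B}[u]=\mathbf{0}$; $\mathrm{wp}(4,8,\mathbb{C})$ is the set of well-posed matrices. Put $\widetilde{\mathbf{M}}^-=\mathbf{M}^-\mathbf{W}(-l)$, $\widetilde{\mathbf{M}}^+=\mathbf{M}^+\mathbf{W}(l)$, $\widetilde{\mathbf{M}}=\widetilde{\mathbf{M}}^-+\widetilde{\mathbf{M}}^+$ (invertible when $\mathbf{M}$ is well-posed). For well-posed $\mathbf{M}$ let $\mathbf{G}_{\mathbf{M}}^\pm=\widetilde{\mathbf{M}}^{-1}\widetilde{\mathbf{M}}^\pm\mathbf{\Omega}\mathbf{L}^2$. Operator. The Green's function is $G_{\mathbf{M}}(x,\xi)=\frac{\alpha}{4k}\mathbf{y}(x)^T\mathbf{G}_{\mathbf{M}}^+\mathbf{y}(\xi)$ if $x\le\xi$ and $-\frac{\alpha}{4k}\mathbf{y}(x)^T\mathbf{G}_{\mathbf{M}}^-\mathbf{y}(\xi)$ if $\xi\le x$, and $\mathcal{K}_{\mathbf{M}}:L^2[-l,l]\to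 L^2[-l,l]$ is $\mathcal{K}_{\mathbf{M}}[w](x)=\int_{-l}^lG_{\mathbf{M}}(x,\xi)w(\xi)\,d\xi$. The matrix $\mathbf{Q}=\left(\begin{array}{cccc|cccc}0&\alpha^2&-\sqrt2\alpha&1&0&0&0&0\\ \sqrt2\alpha^3&-\alpha^2&0&1&0&0&0&0\\0&0&0&0&0&\alpha^2&\sqrt2\alpha&1\\0&0&0&0&-\sqrt2\alpha^3&-\alpha^2&0&1\end{array}\right)$ is well-posed. For $\mathbf{M}\in\mathrm{wp}(4,8,\mathbb{C})$, the $4\times4$ matrix $\mathbf{G}_{\mathbf{M}}$ (not to be confused with the function $G_{\mathbf{M}}$) is $\mathbf{G}_{\mathbf{M}}=(\mathbf{G}_{\mathbf{M}}^+-\mathbf{G}_{\mathbf{Q}}^+)(\mathbf{\Omega}\mathbf{L}^2)^{-1}\mathcal{E}$. $\lambda$-dependent objects. For $\lambda\in\mathbb{C}\setminus\{0,1/k\}$, $\kappa=\chi(\lambda)$ is the unique complex number with $\kappa^4=1-1/(\lambda k)$ and $0\le\operatorname{Arg}\kappa<\pi/2$. For $\lambda\ne0$: $y_{\lambda,j}(x)=\frac{x^{j-1}}{(j-1)!}$ if $\lambda=1/k$, and $y_{\lambda,j}(x)=e^{\omega_j\kappa\alpha x}$ if $\lambda\ne1/k$ ($j=1,2,3,4$); $\mathbf{W}_\lambda(x)=\left(y_{\lambda,q}^{(p-1)}(x)\right)_{1\le p,q\le4}$. For $0\ne\lambda\in\mathbb{C}$ and $x\in\mathbb{R}$, $$\mathbf{X}_\lambda(x)=\mathrm{diag}(0,1,1,0)\mathbf{W}(-x)^{-1}\mathbf{W}_\lambda(-x)+\mathrm{diag}(1,0,0,1)\mathbf{W}(x)^{-1}\mathbf{W}_\lambda(x).$$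 For $0\neq\lambda\notin\operatorname{Spec}\mathcal{K}_{\mathbf{Q}}$ the matrix $\mathbf{X}_\lambda(l)$ is invertible, and $\mathbf{Y}_\lambda(l)=\mathbf{X}_\lambda(-l)\mathbf{X}_\lambda(l)^{-1}-\mathbf{I}$. *)

theory Defs
  imports "HOL-Analysis.Analysis"
begin

text \<open>
  In the numeral type \<open>4\<close> one has \<open>4 = 0\<close>; \<open>idx\<close> reads the elements
  \<open>1, 2, 3, 4\<close> as the row and column numbers 1, 2, 3, 4.
\<close>

definition idx :: "4 \<Rightarrow> nat" where
  "idx p = (if p = 1 then 1 else if p = 2 then 2 else if p = 3 then 3 else 4)"

definition diag :: "complex ^ 4 \<Rightarrow> complex ^ 4 ^ 4" where
  "diag v = (\<chi> i j. if i = j then v $ i else 0)"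

definition omega :: "int \<Rightarrow> complex" where
  "omega j = exp (\<i> * of_real (pi / 4 * (2 * of_int j - 1)))"

definition Omega :: "complex ^ 4 ^ 4" where
  "Omega = diag (vector [omega 1, omega 2, omega 3, omega 4])"

definition Eps :: "complex ^ 4 ^ 4" where
  "Eps = diag (vector [1, -1, -1, 1])"

definition Lsq :: "complex ^ 4 ^ 4" where
  "Lsq = vector
    [vector [0, 0, 1, 0],
     vector [0, 0, 0, 1],
     vector [1, 0, 0, 0],
     vector [0, 1, 0, 0]]"

definition yvec :: "real \<Rightarrow> real \<Rightarrow> complex ^ 4" where
  "yvec \<alpha> x = (\<chi> j. exp (omega (int (idx j)) * of_real \<alpha> * of_real x))"

definition Wmat :: "real \<Rightarrow> real \<Rightarrow> complex ^ 4 ^ 4" where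
  "Wmat \<alpha> x = (\<chi> p q. (omega (int (idx q)) * of_real \<alpha>) ^ (idx p - 1)
                       * exp (omega (int (idx q)) * of_real \<alpha> * of_real x))"

text \<open>
  Iterated derivative of a complex-valued function of a real variable, taken relative to
  the set \<open>S\<close> (one-sided at the end points of a compact interval).
\<close>

definition nth_derivative :: "real set \<Rightarrow> nat \<Rightarrow> (real \<Rightarrow> complex) \<Rightarrow> real \<Rightarrow> complex" where
  "nth_derivative S n u = ((\<lambda>f x. vector_derivative f (at x within S)) ^^ n) u"

definition beam_solution :: "real \<Rightarrow> real \<Rightarrow> (real \<Rightarrow> complex) \<Rightarrow> bool" where
  "beam_solution l \<alpha> u \<longleftrightarrow>
     (\<forall>n<4. \<forall>x\<in>{-l..l}. nth_derivative {-l..l} n u differentiable (at x within {-l..l})) \<and>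
     (\<forall>x\<in>{-l..l}. nth_derivative {-l..l} 4 u x + of_real (\<alpha> ^ 4) * u x = 0)"

definition boundary_values :: "real \<Rightarrow> (real \<Rightarrow> complex) \<Rightarrow> complex ^ 8" where
  "boundary_values l u = vector
    [nth_derivative {-l..l} 0 u (-l), nth_derivative {-l..l} 1 u (-l),
     nth_derivative {-l..l} 2 u (-l), nth_derivative {-l..l} 3 u (-l),
     nth_derivative {-l..l} 0 u l, nth_derivative {-l..l} 1 u l,
     nth_derivative {-l..l} 2 u l, nth_derivative {-l..l} 3 u l]"

definition wp :: "real \<Rightarrow> real \<Rightarrow> (complex ^ 8 ^ 4) set" where
  "wp l \<alpha> = {M. \<forall>u. beam_solution l \<alpha> u \<and> M *v boundary_values l u = 0
                      \<longrightarrow> (\<forall>x\<in>{-l..l}. u x = 0)}"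

definition left_block :: "complex ^ 8 ^ 4 \<Rightarrow> complex ^ 4 ^ 4" where
  "left_block M = (\<chi> i. vector [M $ i $ 1, M $ i $ 2, M $ i $ 3, M $ i $ 4])"

definition right_block :: "complex ^ 8 ^ 4 \<Rightarrow> complex ^ 4 ^ 4" where
  "right_block M = (\<chi> i. vector [M $ i $ 5, M $ i $ 6, M $ i $ 7, M $ i $ 8])"

definition Mtilde_minus :: "real \<Rightarrow> real \<Rightarrow> complex ^ 8 ^ 4 \<Rightarrow> complex ^ 4 ^ 4" where
  "Mtilde_minus l \<alpha> M = left_block M ** Wmat \<alpha> (-l)"

definition Mtilde_plus :: "real \<Rightarrow> real \<Rightarrow> complex ^ 8 ^ 4 \<Rightarrow> complex ^ 4 ^ 4" where
  "Mtilde_plus l \<alpha> M = right_block M ** Wmat \<alpha> l"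

definition Mtilde :: "real \<Rightarrow> real \<Rightarrow> complex ^ 8 ^ 4 \<Rightarrow> complex ^ 4 ^ 4" where
  "Mtilde l \<alpha> M = Mtilde_minus l \<alpha> M + Mtilde_plus l \<alpha> M"

definition G_minus :: "real \<Rightarrow> real \<Rightarrow> complex ^ 8 ^ 4 \<Rightarrow> complex ^ 4 ^ 4" where
  "G_minus l \<alpha> M = matrix_inv (Mtilde l \<alpha> M) ** Mtilde_minus l \<alpha> M ** Omega ** Lsq"

definition G_plus :: "real \<Rightarrow> real \<Rightarrow> complex ^ 8 ^ 4 \<Rightarrow> complex ^ 4 ^ 4" where
  "G_plus l \<alpha> M = matrix_inv (Mtilde l \<alpha> M) ** Mtilde_plus l \<alpha> M ** Omega ** Lsq"

text \<open>The form \<open>v\<^sup>T A w\<close> is bilinear: no complex conjugation.\<close>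

definition bilin :: "complex ^ 4 \<Rightarrow> complex ^ 4 ^ 4 \<Rightarrow> complex ^ 4 \<Rightarrow> complex" where
  "bilin v A w = (\<Sum>i\<in>UNIV. v $ i * (A *v w) $ i)"

text \<open>
  For well-posed \<open>M\<close> the two expressions agree at \<open>x = \<xi>\<close>, since
  \<open>G_minus + G_plus = Omega ** Lsq\<close> and the four numbers \<open>omega j\<close> add up to 0.
\<close>

definition green :: "real \<Rightarrow> real \<Rightarrow> real \<Rightarrow> complex ^ 8 ^ 4 \<Rightarrow> real \<Rightarrow> real \<Rightarrow> complex" where
  "green l \<alpha> k M x \<xi> =
     (if x \<le> \<xi> then of_real (\<alpha> / (4 * k)) * bilin (yvec \<alpha> x) (G_plus l \<alpha> M) (yvec \<alpha> \<xi>)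
      else - of_real (\<alpha> / (4 * k)) * bilin (yvec \<alpha> x) (G_minus l \<alpha> M) (yvec \<alpha> \<xi>))"

definition K_op :: "real \<Rightarrow> real \<Rightarrow> real \<Rightarrow> complex ^ 8 ^ 4 \<Rightarrow> (real \<Rightarrow> complex) \<Rightarrow> real \<Rightarrow> complex" where
  "K_op l \<alpha> k M w x = (LINT \<xi>|lebesgue_on {-l..l}. green l \<alpha> k M x \<xi> * w \<xi>)"

text \<open>
  Elements of \<open>L\<^sup>2[-l,l]\<close> are given by representatives; equality in \<open>L\<^sup>2[-l,l]\<close> is
  equality almost everywhere on \<open>[-l,l]\<close>.
\<close>

definition L2 :: "real \<Rightarrow> (real \<Rightarrow> complex) set" where
  "L2 l = {w. w \<in> borel_measurable (lebesgue_on {-l..l}) \<and>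
              integrable (lebesgue_on {-l..l}) (\<lambda>x. (cmod (w x))\<^sup>2)}"

definition Spec :: "real \<Rightarrow> ((real \<Rightarrow> complex) \<Rightarrow> real \<Rightarrow> complex) \<Rightarrow> complex set" where
  "Spec l T = {\<mu>. \<exists>w\<in>L2 l. \<not> (AE x in lebesgue_on {-l..l}. w x = 0) \<and>
                             (AE x in lebesgue_on {-l..l}. T w x = \<mu> * w x)}"

definition Qmat :: "real \<Rightarrow> complex ^ 8 ^ 4" where
  "Qmat \<alpha> = (let a = complex_of_real \<alpha>; s = complex_of_real (sqrt 2) in vector
    [vector [0, a\<^sup>2, - s * a, 1,     0, 0, 0, 0],
     vector [s * a ^ 3, - (a\<^sup>2), 0, 1,     0, 0, 0, 0],
     vector [0, 0, 0, 0,     0, a\<^sup>2, s * a, 1],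
     vector [0, 0, 0, 0,     - s * a ^ 3, - (a\<^sup>2), 0, 1]])"

definition Gmat :: "real \<Rightarrow> real \<Rightarrow> complex ^ 8 ^ 4 \<Rightarrow> complex ^ 4 ^ 4" where
  "Gmat l \<alpha> M = (G_plus l \<alpha> M - G_plus l \<alpha> (Qmat \<alpha>)) ** matrix_inv (Omega ** Lsq) ** Eps"

definition chi :: "real \<Rightarrow> complex \<Rightarrow> complex" where
  "chi k \<mu> = (THE \<kappa>. \<kappa> ^ 4 = 1 - 1 / (\<mu> * of_real k) \<and> 0 \<le> Arg \<kappa> \<and> Arg \<kappa> < pi / 2)"

definition ylam :: "real \<Rightarrow> real \<Rightarrow> complex \<Rightarrow> nat \<Rightarrow> real \<Rightarrow> complex" where
  "ylam \<alpha> k \<mu> j x =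
     (if \<mu> = of_real (1 / k) then of_real (x ^ (j - 1) / fact (j - 1))
      else exp (omega (int j) * chi k \<mu> * of_real \<alpha> * of_real x))"

definition Wlam :: "real \<Rightarrow> real \<Rightarrow> complex \<Rightarrow> real \<Rightarrow> complex ^ 4 ^ 4" where
  "Wlam \<alpha> k \<mu> x = (\<chi> p q. nth_derivative UNIV (idx p - 1) (ylam \<alpha> k \<mu> (idx q)) x)"

definition Xlam :: "real \<Rightarrow> real \<Rightarrow> complex \<Rightarrow> real \<Rightarrow> complex ^ 4 ^ 4" where
  "Xlam \<alpha> k \<mu> x =
     diag (vector [0, 1, 1, 0]) ** matrix_inv (Wmat \<alpha> (-x)) ** Wlam \<alpha> k \<mu> (-x)
     + diag (vector [1, 0, 0, 1]) ** matrix_inv (Wmat \<alpha> x) ** Wlam \<alpha> k \<mu> x"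

definition Ylam :: "real \<Rightarrow> real \<Rightarrow> real \<Rightarrow> complex \<Rightarrow> complex ^ 4 ^ 4" where
  "Ylam l \<alpha> k \<mu> = Xlam \<alpha> k \<mu> (-l) ** matrix_inv (Xlam \<alpha> k \<mu> l) - mat 1"

end

theory Submission
  imports Defs
begin

text \<open>
  If \<open>K w = \<mu> w\<close> with \<open>\<mu> \<noteq> 0\<close>, then \<open>w\<close> may be taken smooth, and \<open>w\<close> solves
  \<open>u\<^sup>(\<^sup>4\<^sup>) = - \<alpha>\<^sup>4 (1 - 1 / (\<mu> k)) u\<close> with the boundary conditions \<open>M\<close>; conversely,
  variation of constants shows that each such solution is an eigenfunction. Since the columns
  of \<open>Wlam\<close> span the solutions, \<open>\<mu>\<close> is an eigenvalue iff the matrix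
  \<open>M\<^sup>- Wlam (-l) + M\<^sup>+ Wlam l\<close> is singular. For \<open>Qmat\<close> this matrix is
  \<open>Mtilde ** Xlam l\<close>, so \<open>Xlam l\<close> is invertible. With
  \<open>A = W(-l)\<^sup>-\<^sup>1 Wlam (-l)\<close>, \<open>B = W(l)\<^sup>-\<^sup>1 Wlam l\<close>,
  \<open>T = Mtilde\<^sup>-\<^sup>1 Mtilde_plus\<close> for general \<open>M\<close>, the matrix is
  \<open>Mtilde (A + T (B - A))\<close>, while \<open>(Gmat Ylam - 1) Xlam l = - (A + T (B - A))\<close>.
  The value \<open>\<mu> = 0\<close> is never an eigenvalue: \<open>K w = 0\<close> can be differentiated four times
  at almost every point, which gives \<open>w = 0\<close>.
\<close>

subsection \<open>The numbers \<open>omega j\<close> and the Wronskian\<close>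

text \<open>The literals 5 and 6 are 1 and 2 in the type \<open>4\<close>; they arise when
  \<open>q + 2\<close> is evaluated for q = 3 and q = 4.\<close>

lemma idx_simps [simp]: "idx 1 = 1" "idx 2 = 2" "idx 3 = 3" "idx 4 = 4" "idx 5 = 1" "idx 6 = 2"
  by (simp_all add: idx_def)

lemma vector_4_nth [simp]:
  fixes a :: "'a::zero"
  shows "(vector [a, b, c, d] :: 'a ^ 4) $ 1 = a" "(vector [a, b, c, d] :: 'a ^ 4) $ 2 = b"
    "(vector [a, b, c, d] :: 'a ^ 4) $ 3 = c" "(vector [a, b, c, d] :: 'a ^ 4) $ 4 = d"
  by (simp_all add: vector_def)

lemma vector_8_nth [simp]:
  fixes a1 :: "'a::zero"
  shows "(vector [a1, a2, a3, a4, a5, a6, a7, a8] :: 'a ^ 8) $ 1 = a1"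
    "(vector [a1, a2, a3, a4, a5, a6, a7, a8] :: 'a ^ 8) $ 2 = a2"
    "(vector [a1, a2, a3, a4, a5, a6, a7, a8] :: 'a ^ 8) $ 3 = a3"
    "(vector [a1, a2, a3, a4, a5, a6, a7, a8] :: 'a ^ 8) $ 4 = a4"
    "(vector [a1, a2, a3, a4, a5, a6, a7, a8] :: 'a ^ 8) $ 5 = a5"
    "(vector [a1, a2, a3, a4, a5, a6, a7, a8] :: 'a ^ 8) $ 6 = a6"
    "(vector [a1, a2, a3, a4, a5, a6, a7, a8] :: 'a ^ 8) $ 7 = a7"
    "(vector [a1, a2, a3, a4, a5, a6, a7, a8] :: 'a ^ 8) $ 8 = a8"
  by (simp_all add: vector_def)

lemma UNIV_8: "(UNIV :: 8 set) = {1, 2, 3, 4, 5, 6, 7, 8}"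
proof -
  have "card {1, 2, 3, 4, 5, 6, 7, 8 :: 8} = card (UNIV :: 8 set)"
    by simp
  then show ?thesis
    by (metis card_subset_eq finite_class.finite_UNIV subset_UNIV)
qed

lemma sum_8: "sum f (UNIV :: 8 set) = f 1 + f 2 + f 3 + f 4 + f 5 + f 6 + f 7 + f 8"
  unfolding UNIV_8 by (simp add: ac_simps)

lemma matrix_inv_right: "invertible A \<Longrightarrow> A ** matrix_inv A = mat 1"
  and matrix_inv_left: "invertible A \<Longrightarrow> matrix_inv A ** A = mat 1"
  unfolding invertible_def matrix_inv_def by (metis (mono_tags, lifting) someI_ex)+

abbreviation om :: "4 \<Rightarrow> complex" where "om q \<equiv> omega (int (idx q))"

lemma omega_cis: "omega j = cis (pi / 4 * (2 * of_int j - 1))"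
  by (simp add: omega_def cis_conv_exp)

lemma omega_1: "omega 1 = of_real (sqrt 2 / 2) * (1 + \<i>)"
  by (simp add: omega_cis complex_eq_iff cos_45 sin_45)

lemma omega_1_sq: "omega 1 * omega 1 = \<i>"
  unfolding omega_1 by (simp add: complex_eq_iff field_simps)

lemma omega_Suc: "omega (j + 1) = \<i> * omega j"
  unfolding omega_cis by (simp flip: cis_pi_half add: cis_mult) (simp add: field_simps)

lemma omega_eqs: "omega 2 = \<i> * omega 1" "omega 3 = - omega 1" "omega 4 = - \<i> * omega 1"
  using omega_Suc[of 1] omega_Suc[of 2] omega_Suc[of 3] by simp_all

lemma om_power_4 [simp]: "om q ^ 4 = -1"
proof -
  have "omega 1 ^ 4 = (omega 1 * omega 1) ^ 2"
    by (simp add: power_mult_distrib flip: power_add)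
  then have "omega 1 ^ 4 = -1"
    by (simp add: omega_1_sq)
  then show ?thesis
    using exhaust_4[of q] by (auto simp: omega_eqs power_mult_distrib)
qed

lemma om_nonzero [simp]: "om q \<noteq> 0"
  by (simp add: omega_cis)

text \<open>The \<open>om q\<close> are \<open>omega 1\<close> times the fourth roots of unity,
  whose power sums of order 1, 2, 3 vanish. This keeps the Green's function and its first two
  x-derivatives continuous across the diagonal.\<close>

lemma sum_om_power:
  assumes "n < 4" "n \<noteq> 0"
  shows "(\<Sum>q\<in>UNIV. om q ^ n) = 0"
proof -
  have "n = 1 \<or> n = 2 \<or> n = 3"
    using assms by auto
  then show ?thesis
    unfolding sum_4 by (auto simp: omega_eqs power2_eq_square power3_eq_cube)
qed

text \<open>\<open>om q / om r\<close> is a fourth root of unity, and the left side is its full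
  geometric sum. This orthogonality inverts the Wronskian matrix \<open>expW\<close>.\<close>

lemma om_orthogonal: "(\<Sum>p\<in>UNIV. (om q / om r) ^ (idx p - 1)) = (if q = r then 4 else 0)"
proof -
  define s where "s = omega 1"
  have s: "s \<noteq> 0" using om_nonzero[of 1] by (simp add: s_def)
  show ?thesis
    unfolding sum_4 using exhaust_4[of q] exhaust_4[of r] s
    by (elim disjE) (simp_all add: omega_eqs power2_eq_square power3_eq_cube field_simps flip: s_def)
qed

text \<open>Addition in \<open>4\<close> is modulo 4 and each index step is a quarter turn, so 2 is
  half a turn. The permutation \<open>Lsq\<close> thus becomes the shift by 2.\<close>

lemma om_add_2: "om (q + 2) = - om q"
  using exhaust_4[of q] by (elim disjE) (simp_all add: omega_eqs)

lemma Omega_Lsq_nth: "(Omega ** Lsq) $ p $ q = (if q = p + 2 then om p else 0)"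
  using exhaust_4[of q] exhaust_4[of p]
  by (elim disjE) (simp_all add: Omega_def Lsq_def diag_def matrix_matrix_mult_def sum_4)

text \<open>Paired with \<open>yvec\<close> at a second point, this gives exponentials of the
  difference of the two points, the translation-invariant part of the Green's function.\<close>

lemma Omega_Lsq_yvec: "((Omega ** Lsq) *v yvec \<alpha> x) $ q = om q * exp (- om q * of_real \<alpha> * of_real x)"
  by (simp add: matrix_vector_mult_def Omega_Lsq_nth yvec_def om_add_2 if_distrib[of "\<lambda>a. a * _"] cong: if_cong)

lemma invertible_Omega_Lsq: "invertible (Omega ** Lsq)"
proof -
  have "Lsq ** Lsq = mat 1"
    by (simp add: vec_eq_iff matrix_matrix_mult_def sum_4 forall_4 Lsq_def mat_def)
  moreover have "Omega ** diag (\<chi> q. 1 / om q) = mat 1"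
    by (simp add: vec_eq_iff matrix_matrix_mult_def sum_4 forall_4 Omega_def diag_def mat_def) (use om_nonzero[of 1] in \<open>simp add: omega_eqs\<close>)
  ultimately show ?thesis
    by (intro invertible_mult) (auto simp: invertible_right_inverse)
qed

text \<open>Wronskian matrix of the exponential solutions of u^(4) + \<beta>^4 u = 0 for complex
  \<beta>. It is \<open>Wmat\<close> for \<beta> = \<alpha>, and \<open>Wlam\<close> for \<beta> =
  \<open>chi k \<mu> * \<alpha>\<close> when \<mu> \<noteq> 1/k.\<close>

definition expW :: "complex \<Rightarrow> real \<Rightarrow> complex ^ 4 ^ 4" where
  "expW \<beta> x = (\<chi> p q. (om q * \<beta>) ^ (idx p - 1) * exp (om q * \<beta> * of_real x))"

definition expW_inv :: "complex \<Rightarrow> real \<Rightarrow> complex ^ 4 ^ 4" where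
  "expW_inv \<beta> x = (\<chi> q p. exp (- om q * \<beta> * of_real x) / (4 * (om q * \<beta>) ^ (idx p - 1)))"

lemma expW_inv_mult:
  assumes "\<beta> \<noteq> 0"
  shows "expW_inv \<beta> x ** expW \<beta> x = mat 1"
proof -
  have "(expW_inv \<beta> x ** expW \<beta> x) $ q $ r = (if q = r then 1 else 0)" for q r
  proof -
    have "(expW_inv \<beta> x ** expW \<beta> x) $ q $ r =
      exp ((om r - om q) * \<beta> * of_real x) / 4 * (\<Sum>p\<in>UNIV. (om r / om q) ^ (idx p - 1))"
      using assms unfolding sum_distrib_left
      by (auto simp: matrix_matrix_mult_def expW_def expW_inv_def algebra_simps power_mult_distrib
          exp_diff exp_minus divide_simps intro!: sum.cong)
    then show ?thesis
      by (simp only: om_orthogonal) auto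
  qed
  then show ?thesis
    by (simp add: vec_eq_iff mat_def)
qed

lemma Wmat_eq: "Wmat \<alpha> x = expW (of_real \<alpha>) x"
  by (simp add: Wmat_def expW_def)

lemma invertible_expW: "\<beta> \<noteq> 0 \<Longrightarrow> invertible (expW \<beta> x)"
  using expW_inv_mult invertible_left_inverse by blast

subsection \<open>Variation of constants\<close>

text \<open>\<open>u 0\<close> to \<open>u 4\<close> stand for a function and its first four
  derivatives, one-sided at end points of S. Carrying the derivatives as data avoids computing
  iterated \<open>vector_derivative\<close> values.\<close>

definition deriv_chain :: "real set \<Rightarrow> (nat \<Rightarrow> real \<Rightarrow> complex) \<Rightarrow> bool" where
  "deriv_chain S u \<longleftrightarrow>
     (\<forall>n<4. \<forall>x\<in>S. (u n has_vector_derivative u (Suc n) x) (at x within S))"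

definition jet :: "(nat \<Rightarrow> real \<Rightarrow> complex) \<Rightarrow> real \<Rightarrow> complex ^ 4" where
  "jet u x = (\<chi> p. u (idx p - 1) x)"

lemma has_vector_derivative_cexp:
  fixes c :: complex
  shows
  "((\<lambda>x. exp (c * of_real x)) has_vector_derivative c * exp (c * of_real x)) (at x within S)"
proof -
  have "((\<lambda>z. exp (c * z)) has_field_derivative c * exp (c * of_real x)) (at (of_real x))"
    by (auto intro!: derivative_eq_intros)
  from has_vector_derivative_real_field[OF this] show ?thesis .
qed

text \<open>\<open>expW_inv \<beta> t *v jet u t\<close> holds the coordinates of u in the four
  exponentials. In the product rule the terms telescope; only \<open>u 4\<close> and
  \<open>u 0\<close> survive, as the residual of the differential equation.\<close>

lemma variation_of_constants:
  assumes u: "deriv_chain S u" and x: "x \<in> S" and \<beta>: "\<beta> \<noteq> 0"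
  shows "((\<lambda>t. (expW_inv \<beta> t *v jet u t) $ q) has_vector_derivative
          - om q / (4 * \<beta> ^ 3) * exp (- om q * \<beta> * of_real x) * (u 4 x + \<beta> ^ 4 * u 0 x)) (at x within S)"
proof -
  define c where "c = om q * \<beta>"
  have c: "c \<noteq> 0" and c4: "c ^ 4 = - (\<beta> ^ 4)"
    using \<beta> by (simp_all add: c_def power_mult_distrib)
  have du: "(u n has_vector_derivative u (Suc n) x) (at x within S)" if "n < 4" for n
    using u x that by (auto simp: deriv_chain_def)
  have d: "(u 0 has_vector_derivative u 1 x) (at x within S)" "(u 1 has_vector_derivative u 2 x) (at x within S)"
    "(u 2 has_vector_derivative u 3 x) (at x within S)" "(u 3 has_vector_derivative u 4 x) (at x within S)"
    using du[of 0] du[of 1] du[of 2] du[of 3] by (simp_all add: eval_nat_numeral)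
  have e: "(\<lambda>t. (expW_inv \<beta> t *v jet u t) $ q) =
     (\<lambda>t. exp (- c * of_real t) * (u 0 t / 4 + u 1 t / (4 * c) + u 2 t / (4 * c ^ 2) + u 3 t / (4 * c ^ 3)))"
    using c by (auto simp: fun_eq_iff matrix_vector_mult_def sum_4 expW_inv_def jet_def c_def divide_simps ring_distribs)
  \<comment> \<open>\<open>om q ^ 4 = -1\<close> gives 1 / \<open>om q ^ 3\<close> = -
    \<open>om q\<close>.\<close>
  have om: "- om q / (4 * \<beta> ^ 3) = 1 / (4 * c ^ 3)"
    using \<beta> om_power_4[of q, unfolded power4_eq_xxxx]
    by (simp add: c_def divide_simps power_mult_distrib) (simp add: power3_eq_cube mult.assoc)
  have "((\<lambda>t. exp (- c * of_real t) * (u 0 t / 4 + u 1 t / (4 * c) + u 2 t / (4 * c ^ 2) + u 3 t / (4 * c ^ 3)))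
    has_vector_derivative
     exp (- c * of_real x) * (u 1 x / 4 + u 2 x / (4 * c) + u 3 x / (4 * c ^ 2) + u 4 x / (4 * c ^ 3))
      + (- c * exp (- c * of_real x)) * (u 0 x / 4 + u 1 x / (4 * c) + u 2 x / (4 * c ^ 2) + u 3 x / (4 * c ^ 3)))
      (at x within S)"
    by (intro has_vector_derivative_mult has_vector_derivative_cexp has_vector_derivative_add
         has_vector_derivative_divide d)
  also have "exp (- c * of_real x) * (u 1 x / 4 + u 2 x / (4 * c) + u 3 x / (4 * c ^ 2) + u 4 x / (4 * c ^ 3))
      + (- c * exp (- c * of_real x)) * (u 0 x / 4 + u 1 x / (4 * c) + u 2 x / (4 * c ^ 2) + u 3 x / (4 * c ^ 3))
     = exp (- c * of_real x) / (4 * c ^ 3) * (u 4 x - c ^ 4 * u 0 x)"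
    using c by (simp add: divide_simps power4_eq_xxxx power3_eq_cube power2_eq_square) (simp add: algebra_simps)
  finally show ?thesis
    unfolding e om c4 by (simp add: c_def)
qed

subsection \<open>Fundamental matrices \<open>Wlam\<close>\<close>

text \<open>Fourth roots of a nonzero number differ by quarter turns, and a half-open sector of
  opening \<open>pi / 2\<close> holds exactly one of them. This justifies the \<open>THE\<close> in
  \<open>chi\<close>.\<close>

lemma ex1_fourth_root: "\<exists>!\<kappa>. \<kappa> ^ 4 = z \<and> 0 \<le> Arg \<kappa> \<and> Arg \<kappa> < pi / 2"
proof (rule ex_ex1I)
  \<comment> \<open>\<open>Arg\<close> lies in (-pi, pi]; negative values are raised by a full turn
    so that t / 4 falls into [0, pi / 2).\<close>
  define t where "t = (if Arg z \<ge> 0 then Arg z else Arg z + 2 * pi)"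
  have t: "0 \<le> t" "t < 2 * pi"
    using Arg_bounded[of z] by (auto simp: t_def)
  have cis_t: "cis t = cis (Arg z)"
    by (simp add: t_def flip: cis_mult)
  define \<kappa> where "\<kappa> = rcis (root 4 (cmod z)) (t / 4)"
  have "\<kappa> ^ 4 = of_real (root 4 (cmod z) ^ 4) * cis t"
    unfolding \<kappa>_def DeMoivre2 by (simp add: rcis_def)
  also have "root 4 (cmod z) ^ 4 = cmod z"
    by simp
  also have "of_real (cmod z) * cis t = z"
    unfolding cis_t by (metis rcis_cmod_Arg rcis_def)
  finally have "\<kappa> ^ 4 = z" .
  moreover have "0 \<le> Arg \<kappa> \<and> Arg \<kappa> < pi / 2"
  proof (cases "z = 0")
    case True
    \<comment> \<open>\<open>Arg 0\<close> is 0 by convention, which lies in the sector.\<close>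
    then show ?thesis by (simp add: \<kappa>_def Arg_zero)
  next
    case False
    then have "Arg \<kappa> = t / 4"
      using t by (intro Arg_unique[where r = "root 4 (cmod z)"]) (auto simp: \<kappa>_def rcis_def cis_conv_exp)
    then show ?thesis using t by simp
  qed
  ultimately show "\<exists>\<kappa>. \<kappa> ^ 4 = z \<and> 0 \<le> Arg \<kappa> \<and> Arg \<kappa> < pi / 2"
    by blast
next
  fix a b :: complex
  assume a: "a ^ 4 = z \<and> 0 \<le> Arg a \<and> Arg a < pi / 2" and b: "b ^ 4 = z \<and> 0 \<le> Arg b \<and> Arg b < pi / 2"
  have n: "cmod a = cmod b"
    using a b by (metis norm_ge_zero norm_power power_eq_imp_eq_base zero_less_numeral)
  have pow: "w ^ 4 = of_real (cmod w ^ 4) * cis (4 * Arg w)" for w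
    using DeMoivre2[of "cmod w" "Arg w" 4] by (simp add: rcis_cmod_Arg) (simp add: rcis_def)
  show "a = b"
  proof (cases "a = 0")
    case True
    then show ?thesis using n by simp
  next
    case False
    have "of_real (cmod a ^ 4) * cis (4 * Arg a) = of_real (cmod a ^ 4) * cis (4 * Arg b)"
      using a b pow[of a] pow[of b] by (simp add: n)
    then have "cis (4 * Arg a) = cis (4 * Arg b)"
      using False by simp
    then have "cis (4 * Arg a - 4 * Arg b) = 1"
      by (simp flip: cis_divide)
    then have "cos (4 * Arg a - 4 * Arg b) = 1"
      by (metis cis.sel(1) one_complex.sel(1))
    then obtain m :: int where m: "4 * Arg a - 4 * Arg b = real_of_int m * 2 * pi"
      unfolding cos_one_2pi_int by blast
    \<comment> \<open>Both arguments lie in [0, pi / 2), so four times their difference is less than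
      a full turn, which leaves only m = 0.\<close>
    have "\<bar>4 * Arg a - 4 * Arg b\<bar> < 2 * pi"
      using a b by auto
    then have "\<bar>real_of_int m\<bar> * (2 * pi) < 1 * (2 * pi)"
      unfolding m by (metis abs_mult abs_of_pos mult.assoc mult_1 pi_gt_zero zero_less_mult_iff zero_less_numeral)
    then have "\<bar>real_of_int m\<bar> < 1"
      by (rule mult_right_less_imp_less) simp
    then have "m = 0" by linarith
    then have "Arg a = Arg b" using m by simp
    then show ?thesis using rcis_cmod_Arg n by metis
  qed
qed

lemma chi_power_4: "chi k \<mu> ^ 4 = 1 - 1 / (\<mu> * of_real k)"
  unfolding chi_def by (rule the1I2[OF ex1_fourth_root]) blast

lemma nth_derivative_0 [simp]: "nth_derivative S 0 u = u"
  by (simp add: nth_derivative_def)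

lemma nth_derivative_Suc:
  "nth_derivative S (Suc n) u = (\<lambda>x. vector_derivative (nth_derivative S n u) (at x within S))"
  by (simp add: nth_derivative_def)

lemma nth_derivative_UNIV_eq:
  assumes "\<And>n x. (d n has_vector_derivative d (Suc n) x) (at x)"
  shows "nth_derivative UNIV n (d 0) = d n"
  by (induction n) (auto simp: nth_derivative_Suc intro!: vector_derivative_at assms)

text \<open>The test \<open>n \<le> idx q - 1\<close> matters: beyond the degree, truncated
  subtraction would yield x^0 / 0! = 1 instead of 0.\<close>

definition ylam_deriv :: "real \<Rightarrow> real \<Rightarrow> complex \<Rightarrow> 4 \<Rightarrow> nat \<Rightarrow> real \<Rightarrow> complex" where
  "ylam_deriv \<alpha> k \<mu> q n x =
     (if \<mu> = of_real (1 / k)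
      then if n \<le> idx q - 1 then of_real (x ^ (idx q - 1 - n) / fact (idx q - 1 - n)) else 0
      else (om q * chi k \<mu> * of_real \<alpha>) ^ n * exp (om q * chi k \<mu> * of_real \<alpha> * of_real x))"

lemma ylam_deriv_has_vector_derivative:
  "(ylam_deriv \<alpha> k \<mu> q n has_vector_derivative ylam_deriv \<alpha> k \<mu> q (Suc n) x) (at x within S)"
proof (cases "\<mu> = of_real (1 / k)")
  case True
  show ?thesis
  proof (cases "n < idx q - 1")
    case True
    then obtain m where m: "idx q - 1 - n = Suc m" "idx q - 1 - Suc n = m" "n \<le> idx q - 1" "Suc n \<le> idx q - 1"
      by (metis Suc_diff_Suc diff_Suc_eq_diff_pred less_imp_le_nat Suc_leI)
    have "((\<lambda>x. x ^ Suc m / fact (Suc m)) has_real_derivative (real (Suc m) * x ^ m) / fact (Suc m)) (at x within S)"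
      by (intro DERIV_cdivide) (use DERIV_pow[of "Suc m"] in simp)
    then have "((\<lambda>x. x ^ Suc m / fact (Suc m)) has_real_derivative x ^ m / fact m) (at x within S)"
      by (simp del: of_nat_Suc)
    then have "((\<lambda>x. complex_of_real (x ^ Suc m / fact (Suc m))) has_vector_derivative of_real (x ^ m / fact m)) (at x within S)"
      by (intro has_vector_derivative_of_real) (simp add: has_real_derivative_iff_has_vector_derivative)
    then show ?thesis
      using \<open>\<mu> = _\<close> m by (simp add: ylam_deriv_def[abs_def])
  next
    case False
    then show ?thesis
      using \<open>\<mu> = _\<close> by (cases "n = idx q - 1") (simp_all add: ylam_deriv_def[abs_def])
  qed
next
  case False
  define c where "c = om q * chi k \<mu> * of_real \<alpha>"
  have "((\<lambda>x. c ^ n * exp (c * of_real x)) has_vector_derivative c ^ n * (c * exp (c * of_real x))) (at x within S)"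
    by (intro has_vector_derivative_mult_right has_vector_derivative_cexp)
  then show ?thesis
    using False by (simp add: ylam_deriv_def[abs_def] flip: c_def) (simp add: mult_ac)
qed

lemma ylam_nth_derivative: "nth_derivative UNIV n (ylam \<alpha> k \<mu> (idx q)) = ylam_deriv \<alpha> k \<mu> q n"
proof -
  have "ylam \<alpha> k \<mu> (idx q) = ylam_deriv \<alpha> k \<mu> q 0"
    by (auto simp: fun_eq_iff ylam_def ylam_deriv_def)
  then show ?thesis
    by (simp add: nth_derivative_UNIV_eq ylam_deriv_has_vector_derivative)
qed

lemma Wlam_eq: "Wlam \<alpha> k \<mu> x = (\<chi> p q. ylam_deriv \<alpha> k \<mu> q (idx p - 1) x)"
  by (simp add: Wlam_def ylam_nth_derivative)

lemma ylam_deriv_4: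
  assumes "\<mu> \<noteq> 0" "k \<noteq> 0"
  shows "ylam_deriv \<alpha> k \<mu> q 4 x = - (of_real \<alpha> ^ 4 * (1 - 1 / (\<mu> * of_real k))) * ylam_deriv \<alpha> k \<mu> q 0 x"
proof (cases "\<mu> = of_real (1 / k)")
  case True
  then show ?thesis
    using assms exhaust_4[of q] by (auto simp: ylam_deriv_def)
next
  case False
  then show ?thesis
    by (simp add: ylam_deriv_def power_mult_distrib chi_power_4 algebra_simps)
qed

definition lam_solution :: "real \<Rightarrow> real \<Rightarrow> complex \<Rightarrow> complex ^ 4 \<Rightarrow> nat \<Rightarrow> real \<Rightarrow> complex" where
  "lam_solution \<alpha> k \<mu> b n x = (\<Sum>q\<in>UNIV. ylam_deriv \<alpha> k \<mu> q n x * b $ q)"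

lemma jet_lam_solution: "jet (lam_solution \<alpha> k \<mu> b) x = Wlam \<alpha> k \<mu> x *v b"
  by (simp add: jet_def lam_solution_def Wlam_eq matrix_vector_mult_def)

lemma deriv_chain_lam_solution: "deriv_chain S (lam_solution \<alpha> k \<mu> b)"
  unfolding deriv_chain_def lam_solution_def
  by (auto intro!: has_vector_derivative_sum has_vector_derivative_mult_left ylam_deriv_has_vector_derivative)

lemma lam_solution_4:
  assumes "\<mu> \<noteq> 0" "k \<noteq> 0"
  shows "lam_solution \<alpha> k \<mu> b 4 x = - (of_real \<alpha> ^ 4 * (1 - 1 / (\<mu> * of_real k))) * lam_solution \<alpha> k \<mu> b 0 x"
  unfolding lam_solution_def ylam_deriv_4[OF assms] by (simp add: sum_distrib_left mult.assoc)

text \<open>R is the inverse of the fundamental matrix, and \<open>R t *v jet u t\<close> are the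
  coordinates of u in its columns, which do not vary along solutions. The \<open>obtains\<close>
  form hides the split into polynomials (\<mu> = 1/k) and exponentials.\<close>

lemma Wlam_fundamental:
  assumes "\<mu> \<noteq> 0" "k \<noteq> 0" "\<alpha> \<noteq> 0"
  obtains R where "\<And>x. R x ** Wlam \<alpha> k \<mu> x = mat 1" "\<And>x. Wlam \<alpha> k \<mu> x ** R x = mat 1"
    "\<And>u S x q. \<lbrakk>deriv_chain S u; x \<in> S; u 4 x = - (of_real \<alpha> ^ 4 * (1 - 1 / (\<mu> * of_real k))) * u 0 x\<rbrakk>
      \<Longrightarrow> ((\<lambda>t. (R t *v jet u t) $ q) has_vector_derivative 0) (at x within S)"
proof (cases "\<mu> = of_real (1 / k)")
  case True
  show ?thesis
  \<comment> \<open>Here \<open>Wlam\<close> at x is exp (x N) with N the nilpotent shift, so its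
    inverse is its value at -x.\<close>
  proof (rule that[of "\<lambda>x. Wlam \<alpha> k \<mu> (- x)"])
    have *: "Wlam \<alpha> k \<mu> x ** Wlam \<alpha> k \<mu> (- x) = mat 1" for x
      using True
      by (simp add: vec_eq_iff forall_4 Wlam_eq matrix_matrix_mult_def sum_4 ylam_deriv_def mat_def fact_numeral)
        (simp add: power2_eq_square)
    show "Wlam \<alpha> k \<mu> x ** Wlam \<alpha> k \<mu> (- x) = mat 1" "Wlam \<alpha> k \<mu> (- x) ** Wlam \<alpha> k \<mu> x = mat 1" for x
      using *[of x] *[of "- x"] by simp_all
  next
    fix u S x q
    assume u: "deriv_chain S u" and x: "x \<in> S" and u4: "u 4 x = - (of_real \<alpha> ^ 4 * (1 - 1 / (\<mu> * of_real k))) * u 0 x"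
    have u40: "u (Suc (Suc (Suc (Suc 0)))) x = 0"
      using True assms u4 by (simp add: eval_nat_numeral)
    have du: "(u n has_vector_derivative u (Suc n) x) (at x within S)" if "n < 4" for n
      using u x that by (auto simp: deriv_chain_def)
    have dy: "((\<lambda>t. ylam_deriv \<alpha> k \<mu> p n (- t)) has_vector_derivative - ylam_deriv \<alpha> k \<mu> p (Suc n) (- x)) (at x within S)" for p n
    proof -
      have "(uminus has_vector_derivative (-1 :: real)) (at x within S)"
        by (auto intro!: derivative_eq_intros)
      from vector_diff_chain_within[OF this ylam_deriv_has_vector_derivative] show ?thesis
        by (simp add: o_def)
    qed
    \<comment> \<open>The second part of each summand cancels the first part of the preceding one;
      what is left is a multiple of \<open>u 4 x\<close>, which is 0 for \<mu> = 1/k.\<close>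
    have "(\<Sum>p\<in>UNIV. ylam_deriv \<alpha> k \<mu> p (idx q - 1) (- x) * u (Suc (idx p - 1)) x +
           - ylam_deriv \<alpha> k \<mu> p (Suc (idx q - 1)) (- x) * u (idx p - 1) x) = 0"
      using exhaust_4[of q] True
      by (elim disjE) (simp_all add: sum_4 ylam_deriv_def u40 eval_nat_numeral)
    moreover have "((\<lambda>t. \<Sum>p\<in>UNIV. ylam_deriv \<alpha> k \<mu> p (idx q - 1) (- t) * u (idx p - 1) t) has_vector_derivative
        (\<Sum>p\<in>UNIV. ylam_deriv \<alpha> k \<mu> p (idx q - 1) (- x) * u (Suc (idx p - 1)) x +
           - ylam_deriv \<alpha> k \<mu> p (Suc (idx q - 1)) (- x) * u (idx p - 1) x)) (at x within S)"
      by (intro has_vector_derivative_sum has_vector_derivative_mult dy du) (simp add: idx_def)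
    moreover have "(\<lambda>t. (Wlam \<alpha> k \<mu> (- t) *v jet u t) $ q) =
        (\<lambda>t. \<Sum>p\<in>UNIV. ylam_deriv \<alpha> k \<mu> p (idx q - 1) (- t) * u (idx p - 1) t)"
      by (simp add: fun_eq_iff matrix_vector_mult_def Wlam_eq jet_def)
    ultimately show "((\<lambda>t. (Wlam \<alpha> k \<mu> (- t) *v jet u t) $ q) has_vector_derivative 0) (at x within S)"
      by (simp only:)
  qed
next
  case False
  define \<beta> where "\<beta> = chi k \<mu> * of_real \<alpha>"
  have "chi k \<mu> \<noteq> 0"
    using False assms chi_power_4[of k \<mu>] by (auto simp: field_simps)
  then have \<beta>: "\<beta> \<noteq> 0" and \<beta>4: "\<beta> ^ 4 = of_real \<alpha> ^ 4 * (1 - 1 / (\<mu> * of_real k))"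
    using assms by (simp_all add: \<beta>_def power_mult_distrib chi_power_4)
  have W: "Wlam \<alpha> k \<mu> x = expW \<beta> x" for x
    using False by (simp add: vec_eq_iff Wlam_eq expW_def ylam_deriv_def \<beta>_def mult_ac)
  show ?thesis
  proof (rule that[of "expW_inv \<beta>"])
    show *: "expW_inv \<beta> x ** Wlam \<alpha> k \<mu> x = mat 1" for x
      unfolding W by (rule expW_inv_mult[OF \<beta>])
    show "Wlam \<alpha> k \<mu> x ** expW_inv \<beta> x = mat 1" for x
      using * matrix_left_right_inverse by blast
  next
    fix u S x q
    assume u: "deriv_chain S u" and x: "x \<in> S" and u4: "u 4 x = - (of_real \<alpha> ^ 4 * (1 - 1 / (\<mu> * of_real k))) * u 0 x"
    show "((\<lambda>t. (expW_inv \<beta> t *v jet u t) $ q) has_vector_derivative 0) (at x within S)"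
      using variation_of_constants[OF u x \<beta>, of q] by (simp add: u4 \<beta>4)
  qed
qed

text \<open>The coordinates in the columns of \<open>Wlam\<close> are constant on the interval, so
  their value at a serves as c.\<close>

lemma jet_eq_Wlam:
  assumes "\<mu> \<noteq> 0" "k \<noteq> 0" "\<alpha> \<noteq> 0" and u: "deriv_chain {a..b} u" 
    and u4: "\<And>x. x \<in> {a..b} \<Longrightarrow> u 4 x = - (of_real \<alpha> ^ 4 * (1 - 1 / (\<mu> * of_real k))) * u 0 x"
  obtains c where "\<And>x. x \<in> {a..b} \<Longrightarrow> jet u x = Wlam \<alpha> k \<mu> x *v c"
proof -
  obtain R where R: "\<And>x. Wlam \<alpha> k \<mu> x ** R x = mat 1"
    and dR: "\<And>x q. x \<in> {a..b} \<Longrightarrow> ((\<lambda>t. (R t *v jet u t) $ q) has_vector_derivative 0) (at x within {a..b})"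
  proof (rule Wlam_fundamental[OF assms(1-3)])
    fix R
    assume *: "\<And>x. Wlam \<alpha> k \<mu> x ** R x = mat 1"
      "\<And>u S x q. \<lbrakk>deriv_chain S u; x \<in> S; u 4 x = - (of_real \<alpha> ^ 4 * (1 - 1 / (\<mu> * of_real k))) * u 0 x\<rbrakk>
        \<Longrightarrow> ((\<lambda>t. (R t *v jet u t) $ q) has_vector_derivative 0) (at x within S)"
    show thesis
      by (rule that[OF *(1) *(2)[OF u _ u4]])
  qed
  have const: "(R x *v jet u x) $ q = (R a *v jet u a) $ q" if x: "x \<in> {a..b}" for x q
  proof (rule has_vector_derivative_zero_constant[of "{a..b}" "\<lambda>t. (R t *v jet u t) $ q"])
    fix c
    assume c: "\<And>x. x \<in> {a..b} \<Longrightarrow> (R x *v jet u x) $ q = c"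
    show ?thesis
      using c[OF x] c[of a] x by simp
  qed (simp, rule dR)
  have "jet u x = Wlam \<alpha> k \<mu> x *v (R a *v jet u a)" if "x \<in> {a..b}" for x
  proof -
    have "R a *v jet u a = R x *v jet u x"
      using const[OF that] by (simp add: vec_eq_iff)
    then show ?thesis
      by (simp add: matrix_vector_mul_assoc R)
  qed
  then show ?thesis ..
qed

subsection \<open>Integration against the Green's function\<close>

lemma integrable_exp_mult:
  fixes c :: complex
  assumes "integrable (lebesgue_on {a..b}) w"
  shows "integrable (lebesgue_on {a..b}) (\<lambda>x. exp (c * of_real x) * w x)"
proof -
  have cont: "continuous_on {a..b} (\<lambda>x. exp (c * of_real x))"
    by (intro continuous_intros)
  have "compact ((\<lambda>x. exp (c * of_real x)) ` {a..b})"
    by (intro compact_continuous_image cont compact_Icc)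
  then obtain B where B: "\<And>x. x \<in> {a..b} \<Longrightarrow> cmod (exp (c * of_real x)) \<le> B"
    by (meson bounded_iff compact_imp_bounded imageI)
  show ?thesis
  proof (rule Bochner_Integration.integrable_bound)
    show "integrable (lebesgue_on {a..b}) (\<lambda>x. B * cmod (w x))"
      using assms by simp
    show "(\<lambda>x. exp (c * of_real x) * w x) \<in> borel_measurable (lebesgue_on {a..b})"
      by (intro borel_measurable_times borel_measurable_integrable[OF assms]
          continuous_imp_measurable_on_sets_lebesgue cont) simp
    show "AE x in lebesgue_on {a..b}. norm (exp (c * of_real x) * w x) \<le> norm (B * cmod (w x))"
    proof (rule AE_I2)
      fix x assume "x \<in> space (lebesgue_on {a..b})"
      then have "cmod (exp (c * of_real x)) \<le> \<bar>B\<bar>"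
        using B[of x] by (simp del: norm_exp_eq_Re)
      then show "norm (exp (c * of_real x) * w x) \<le> norm (B * cmod (w x))"
        by (simp add: norm_mult abs_mult mult_right_mono del: norm_exp_eq_Re)
    qed
  qed
qed

text \<open>Turns the part t \<le> x of a Lebesgue integral into a Henstock-Kurzweil integral with
  upper limit x, which can be differentiated in x.\<close>

lemma has_bochner_integral_upto:
  fixes g :: "real \<Rightarrow> complex"
  assumes g: "integrable (lebesgue_on {a..b}) g" and x: "x \<in> {a..b}"
  shows "has_bochner_integral (lebesgue_on {a..b}) (\<lambda>t. if t \<le> x then g t else 0) (integral {a..x} g)"
proof -
  have "integrable (lebesgue_on {a..b}) (\<lambda>t. indicator {a..x} t *\<^sub>R g t)"
    using x by (intro integrable_mult_indicator g) (auto simp: sets_restrict_space_iff)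
  then have i: "integrable (lebesgue_on {a..b}) (\<lambda>t. if t \<le> x then g t else 0)"
    by (rule Bochner_Integration.integrable_cong[THEN iffD1, rotated -1]) auto
  have "integral {a..b} (\<lambda>t. if t \<in> {..x} then g t else 0) = integral ({..x} \<inter> {a..b}) g"
    by (rule Henstock_Kurzweil_Integration.integral_restrict_Int)
  also have "{..x} \<inter> {a..b} = {a..x}"
    using x by auto
  finally show ?thesis
    using i lebesgue_integral_eq_integral[OF i] by (simp add: has_bochner_integral_iff)
qed

text \<open>Coordinates of K w at x in the exponentials \<open>exp (om q * \<alpha> * x)\<close>.
  The first sum is independent of x; all variation sits in the Volterra integral over
  [-l, x].\<close>

definition green_coeff :: "real \<Rightarrow> real \<Rightarrow> real \<Rightarrow> complex ^ 8 ^ 4 \<Rightarrow> (real \<Rightarrow> complex) \<Rightarrow> real \<Rightarrow> complex ^ 4" where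
  "green_coeff l \<alpha> k M w x = (\<chi> q. of_real (\<alpha> / (4 * k)) *
     ((\<Sum>r\<in>UNIV. G_plus l \<alpha> M $ q $ r * integral {-l..l} (\<lambda>\<xi>. exp (om r * of_real \<alpha> * of_real \<xi>) * w \<xi>))
       - om q * integral {-l..x} (\<lambda>\<xi>. exp (- om q * of_real \<alpha> * of_real \<xi>) * w \<xi>)))"

lemma G_plus_minus:
  assumes "invertible (Mtilde l \<alpha> M)"
  shows "G_plus l \<alpha> M + G_minus l \<alpha> M = Omega ** Lsq"
proof -
  have "G_plus l \<alpha> M + G_minus l \<alpha> M =
      matrix_inv (Mtilde l \<alpha> M) ** (Mtilde_plus l \<alpha> M ** Omega ** Lsq + Mtilde_minus l \<alpha> M ** Omega ** Lsq)"
    by (simp add: G_plus_def G_minus_def matrix_add_ldistrib matrix_mul_assoc)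
  also have "Mtilde_plus l \<alpha> M ** Omega ** Lsq + Mtilde_minus l \<alpha> M ** Omega ** Lsq
      = Mtilde l \<alpha> M ** Omega ** Lsq"
    unfolding Mtilde_def by (simp add: vec_eq_iff matrix_matrix_mult_def sum_4 algebra_simps)
  finally have "G_plus l \<alpha> M + G_minus l \<alpha> M =
      (matrix_inv (Mtilde l \<alpha> M) ** Mtilde l \<alpha> M) ** Omega ** Lsq"
    by (simp add: matrix_mul_assoc)
  then show ?thesis
    using assms by (simp add: matrix_inv_left)
qed

text \<open>Replacing \<open>G_minus\<close> by \<open>Omega ** Lsq - G_plus\<close> merges the two
  branches into a term for all \<xi> and a correction for \<xi> \<le> x.\<close>

lemma green_eq:
  assumes M: "invertible (Mtilde l \<alpha> M)"
  shows "green l \<alpha> k M x \<xi> = of_real (\<alpha> / (4 * k)) * (\<Sum>q\<in>UNIV. exp (om q * of_real \<alpha> * of_real x) *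
     ((\<Sum>r\<in>UNIV. G_plus l \<alpha> M $ q $ r * exp (om r * of_real \<alpha> * of_real \<xi>))
       - om q * (if \<xi> \<le> x then exp (- om q * of_real \<alpha> * of_real \<xi>) else 0)))"
proof -
  let ?y = "\<lambda>q x. exp (om q * of_real \<alpha> * of_real x)"
  have p: "bilin (yvec \<alpha> x) (G_plus l \<alpha> M) (yvec \<alpha> \<xi>) =
      (\<Sum>q\<in>UNIV. ?y q x * (\<Sum>r\<in>UNIV. G_plus l \<alpha> M $ q $ r * ?y r \<xi>))"
    by (simp add: bilin_def yvec_def matrix_vector_mult_def)
  have "G_minus l \<alpha> M *v yvec \<alpha> \<xi> = (Omega ** Lsq) *v yvec \<alpha> \<xi> - G_plus l \<alpha> M *v yvec \<alpha> \<xi>"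
    using G_plus_minus[OF M] by (metis add_diff_cancel_left' matrix_vector_mult_diff_rdistrib)
  then have m: "bilin (yvec \<alpha> x) (G_minus l \<alpha> M) (yvec \<alpha> \<xi>) =
      - (\<Sum>q\<in>UNIV. ?y q x * ((\<Sum>r\<in>UNIV. G_plus l \<alpha> M $ q $ r * ?y r \<xi>) - om q * exp (- om q * of_real \<alpha> * of_real \<xi>)))"
    by (simp add: bilin_def Omega_Lsq_yvec flip: sum_negf)
      (auto simp: yvec_def matrix_vector_mult_def algebra_simps intro!: sum.cong)
  show ?thesis
  proof (cases "\<xi> = x")
    case True
    \<comment> \<open>On the diagonal the definition takes the first branch while the formula
      includes the correction; the latter is proportional to the sum of the \<open>om q\<close>,
      hence 0.\<close>
    have "(\<Sum>q\<in>UNIV. ?y q x * (om q * exp (- om q * of_real \<alpha> * of_real x))) = (\<Sum>q\<in>UNIV. om q ^ 1)"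
      by (auto simp: mult.left_commute simp flip: exp_add intro!: sum.cong)
    also have "\<dots> = 0"
      by (rule sum_om_power) auto
    finally show ?thesis
      unfolding green_def p using True by (simp add: right_diff_distrib sum_subtractf)
  next
    case False
    then show ?thesis
      by (auto simp: green_def p m)
  qed
qed

lemma K_op_eq:
  assumes M: "invertible (Mtilde l \<alpha> M)" and w: "integrable (lebesgue_on {-l..l}) w" and x: "x \<in> {-l..l}"
  shows "K_op l \<alpha> k M w x = (\<Sum>q\<in>UNIV. exp (om q * of_real \<alpha> * of_real x) * green_coeff l \<alpha> k M w x $ q)"
proof -
  let ?y = "\<lambda>q x. exp (om q * of_real \<alpha> * of_real x)"
  let ?z = "\<lambda>q x. exp (- om q * of_real \<alpha> * of_real x)"
  have y: "has_bochner_integral (lebesgue_on {-l..l}) (\<lambda>\<xi>. ?y q \<xi> * w \<xi>) (integral {-l..l} (\<lambda>\<xi>. ?y q \<xi> * w \<xi>))" for q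
    using integrable_exp_mult[OF w, of "om q * of_real \<alpha>"]
    by (auto simp: has_bochner_integral_iff lebesgue_integral_eq_integral)
  have z: "has_bochner_integral (lebesgue_on {-l..l}) (\<lambda>\<xi>. if \<xi> \<le> x then ?z q \<xi> * w \<xi> else 0)
      (integral {-l..x} (\<lambda>\<xi>. ?z q \<xi> * w \<xi>))" for q
    using has_bochner_integral_upto[OF integrable_exp_mult[OF w, of "- om q * of_real \<alpha>"] x] by simp
  have "has_bochner_integral (lebesgue_on {-l..l})
     (\<lambda>\<xi>. of_real (\<alpha> / (4 * k)) * (\<Sum>q\<in>UNIV. ?y q x *
       ((\<Sum>r\<in>UNIV. G_plus l \<alpha> M $ q $ r * (?y r \<xi> * w \<xi>)) - om q * (if \<xi> \<le> x then ?z q \<xi> * w \<xi> else 0))))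
     (of_real (\<alpha> / (4 * k)) * (\<Sum>q\<in>UNIV. ?y q x *
       ((\<Sum>r\<in>UNIV. G_plus l \<alpha> M $ q $ r * integral {-l..l} (\<lambda>\<xi>. ?y r \<xi> * w \<xi>))
         - om q * integral {-l..x} (\<lambda>\<xi>. ?z q \<xi> * w \<xi>))))"
    by (intro has_bochner_integral_mult_right has_bochner_integral_sum has_bochner_integral_diff y z)
  also have "(\<lambda>\<xi>. of_real (\<alpha> / (4 * k)) * (\<Sum>q\<in>UNIV. ?y q x *
       ((\<Sum>r\<in>UNIV. G_plus l \<alpha> M $ q $ r * (?y r \<xi> * w \<xi>)) - om q * (if \<xi> \<le> x then ?z q \<xi> * w \<xi> else 0))))
     = (\<lambda>\<xi>. green l \<alpha> k M x \<xi> * w \<xi>)"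
    unfolding green_eq[OF M]
    by (auto simp: fun_eq_iff sum_distrib_right left_diff_distrib mult.assoc intro!: sum.cong)
  finally have "K_op l \<alpha> k M w x = of_real (\<alpha> / (4 * k)) * (\<Sum>q\<in>UNIV. ?y q x *
       ((\<Sum>r\<in>UNIV. G_plus l \<alpha> M $ q $ r * integral {-l..l} (\<lambda>\<xi>. ?y r \<xi> * w \<xi>))
         - om q * integral {-l..x} (\<lambda>\<xi>. ?z q \<xi> * w \<xi>)))"
    unfolding K_op_def by (rule has_bochner_integral_integral_eq)
  then show ?thesis
    unfolding green_coeff_def by (simp add: sum_distrib_left mult.left_commute)
qed

section \<open>Null sets and differentiation of primitives almost everywhere\<close>

lemma AE_lebesgue_on_iff_negligible:
  assumes "S \<in> sets lebesgue"
  shows "(AE x in lebesgue_on S. P x) \<longleftrightarrow> (\<exists>N. negligible N \<and> (\<forall>x\<in>S - N. P x))"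
proof -
  have "(AE x in lebesgue_on S. P x) \<longleftrightarrow> (AE x in lebesgue. x \<in> S \<longrightarrow> P x)"
    using assms by (simp add: AE_restrict_space_iff)
  then show ?thesis
    unfolding eventually_ae_filter negligible_iff_null_sets by auto
qed

text \<open>The integral of |f| ignores N, hence is 0, and a continuous nonnegative function with
  integral 0 on [a, b] vanishes.\<close>

lemma continuous_negligible_imp_zero:
  fixes f :: "real \<Rightarrow> complex"
  assumes f: "continuous_on {a..b} f" and "a < b" and N: "negligible N"
    and 0: "\<And>x. x \<in> {a..b} - N \<Longrightarrow> f x = 0" and x: "x \<in> {a..b}"
  shows "f x = 0"
proof -
  have "integral {a..b} (\<lambda>x. cmod (f x)) = integral {a..b} (\<lambda>x. 0 :: real)"
    using 0 by (intro integral_spike[OF N]) auto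
  moreover have "continuous_on {a..b} (\<lambda>x. cmod (f x))"
    by (intro continuous_intros f)
  ultimately have "\<forall>x\<in>{a..b}. cmod (f x) = 0"
    using \<open>a < b\<close> by (subst integral_eq_0_iff[symmetric]) auto
  then show ?thesis
    using x by auto
qed

text \<open>Lebesgue differentiation for Henstock-Kurzweil primitives. The averages are over
  [x, x + h] with h > 0, so the derivatives are from the right.\<close>

lemma indefinite_integral_right_derivative:
  fixes g :: "real \<Rightarrow> complex"
  assumes g: "g integrable_on {a..b}"
  obtains N where "negligible N"
    "\<And>x. x \<in> {a..<b} - N \<Longrightarrow> ((\<lambda>y. integral {a..y} g) has_vector_derivative g x) (at x within {x..b})"
proof -
  \<comment> \<open>Extension by 0 makes the function integrable on every interval, as the theorem
    on averages requires.\<close>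
  define g0 where "g0 x = (if x \<in> {a..b} then g x else 0)" for x
  have "g0 integrable_on cbox c d" for c d
    unfolding g0_def by (rule integrable_altD(1)[OF g])
  then obtain N where N: "negligible N"
    "\<And>x e. \<lbrakk>x \<notin> N; 0 < e\<rbrakk> \<Longrightarrow> \<exists>d>0. \<forall>h. 0 < h \<and> h < d \<longrightarrow>
       norm (integral (cbox x (x + h *\<^sub>R One)) g0 /\<^sub>R h ^ DIM(real) - g0 x) < e"
    using integrable_ccontinuous_explicit[of g0] by metis
  have "((\<lambda>y. integral {a..y} g) has_vector_derivative g x) (at x within {x..b})" if x: "x \<in> {a..<b} - N" for x
    unfolding has_vector_derivative_def has_derivative_within_alt
  proof (intro conjI allI impI)
    fix e :: real
    assume "0 < e"
    obtain d where d: "d > 0" "\<And>h. \<lbrakk>0 < h; h < d\<rbrakk> \<Longrightarrow> norm (integral {x..x + h} g0 /\<^sub>R h - g0 x) < e"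
      using N(2)[of x e] x \<open>0 < e\<close> by auto
    have "norm (integral {a..y} g - integral {a..x} g - (y - x) *\<^sub>R g x) \<le> e * norm (y - x)"
      if y: "y \<in> {x..b}" "norm (y - x) < d" for y
    proof (cases "y = x")
      case False
      define h where "h = y - x"
      have h: "0 < h" "h < d" "y = x + h"
        using y False by (auto simp: h_def)
      have g0x: "g0 x = g x"
        using x by (simp add: g0_def)
      have "g integrable_on {a..y}"
        using y x by (intro integrable_subinterval_real[OF g]) auto
      then have "integral {a..y} g = integral {a..x} g + integral {x..y} g"
        using x y by (intro Henstock_Kurzweil_Integration.integral_combine[symmetric]) auto
      moreover have "integral {x..y} g = integral {x..y} g0"
        using x y by (intro integral_cong) (auto simp: g0_def)
      ultimately have "integral {a..y} g - integral {a..x} g - (y - x) *\<^sub>R g x = h *\<^sub>R (integral {x..x + h} g0 /\<^sub>R h - g0 x)"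
        using h(1) g0x unfolding h(3) by (simp add: scaleR_diff_right)
      then have "norm (integral {a..y} g - integral {a..x} g - (y - x) *\<^sub>R g x) = h * norm (integral {x..x + h} g0 /\<^sub>R h - g0 x)"
        using h by simp
      also have "\<dots> \<le> h * e"
        using d(2)[of h] h by (intro mult_left_mono) auto
      finally show ?thesis
        using h by (simp add: mult.commute)
    qed simp
    then show "\<exists>d>0. \<forall>y\<in>{x..b}. norm (y - x) < d \<longrightarrow>
        norm (integral {a..y} g - integral {a..x} g - (y - x) *\<^sub>R g x) \<le> e * norm (y - x)"
      using d(1) by blast
  qed (rule bounded_linear_scaleR_left)
  with N(1) show ?thesis ..
qed

section \<open>Derivatives of K w and injectivity of K\<close>

definition green_deriv :: "real \<Rightarrow> real \<Rightarrow> real \<Rightarrow> complex ^ 8 ^ 4 \<Rightarrow> (real \<Rightarrow> complex) \<Rightarrow> nat \<Rightarrow> real \<Rightarrow> complex" where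
  "green_deriv l \<alpha> k M w n x =
     (\<Sum>q\<in>UNIV. (om q * of_real \<alpha>) ^ n * exp (om q * of_real \<alpha> * of_real x) * green_coeff l \<alpha> k M w x $ q)"

lemma K_op_eq_green_deriv:
  assumes "invertible (Mtilde l \<alpha> M)" "integrable (lebesgue_on {-l..l}) w" "x \<in> {-l..l}"
  shows "K_op l \<alpha> k M w x = green_deriv l \<alpha> k M w 0 x"
  by (simp add: K_op_eq[OF assms] green_deriv_def)

lemma jet_green_deriv: "jet (green_deriv l \<alpha> k M w) x = Wmat \<alpha> x *v green_coeff l \<alpha> k M w x"
  by (simp add: jet_def green_deriv_def Wmat_def matrix_vector_mult_def)

lemma green_deriv_4: "green_deriv l \<alpha> k M w 4 x = - (of_real \<alpha> ^ 4 * green_deriv l \<alpha> k M w 0 x)"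
  by (simp add: green_deriv_def power_mult_distrib sum_distrib_left sum_negf mult.assoc)

lemma integrable_on_exp_mult:
  fixes w :: "real \<Rightarrow> complex"
  assumes "integrable (lebesgue_on {a..b}) w"
  shows "(\<lambda>x. exp (c * of_real x) * w x) integrable_on {a..b}"
  by (intro integrable_on_lebesgue_on integrable_exp_mult assms) simp

lemma continuous_on_green_deriv:
  assumes w: "integrable (lebesgue_on {-l..l}) w"
  shows "continuous_on {-l..l} (green_deriv l \<alpha> k M w n)"
  unfolding green_deriv_def green_coeff_def vec_lambda_beta
  by (intro continuous_intros indefinite_integral_continuous_1 integrable_on_exp_mult[OF w])

lemma green_coeff_has_vector_derivative:
  assumes "((\<lambda>y. integral {-l..y} (\<lambda>\<xi>. exp (- om q * of_real \<alpha> * of_real \<xi>) * w \<xi>)) has_vector_derivative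
      exp (- om q * of_real \<alpha> * of_real x) * w x) (at x within S)"
  shows "((\<lambda>y. green_coeff l \<alpha> k M w y $ q) has_vector_derivative
      - of_real (\<alpha> / (4 * k)) * (om q * (exp (- om q * of_real \<alpha> * of_real x) * w x))) (at x within S)"
proof -
  have "((\<lambda>y. green_coeff l \<alpha> k M w y $ q) has_vector_derivative
      of_real (\<alpha> / (4 * k)) * (0 - om q * (exp (- om q * of_real \<alpha> * of_real x) * w x))) (at x within S)"
    unfolding green_coeff_def vec_lambda_beta
    by (intro has_vector_derivative_mult_right has_vector_derivative_diff has_vector_derivative_const assms)
  then show ?thesis
    by simp
qed

text \<open>\<open>green_deriv\<close> differentiates only the exponentials. The derivatives of the
  coefficients contribute a multiple of the sum of \<open>om q ^ (n + 1)\<close>, which is 0 for n <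
  3 and -4 for n = 3. The pointwise hypothesis covers both continuous w and almost every x for
  integrable w.\<close>

lemma green_deriv_has_vector_derivative:
  assumes "\<And>q. ((\<lambda>y. integral {-l..y} (\<lambda>\<xi>. exp (- om q * of_real \<alpha> * of_real \<xi>) * w \<xi>)) has_vector_derivative
      exp (- om q * of_real \<alpha> * of_real x) * w x) (at x within S)" and n: "n < 4" 
  shows "(green_deriv l \<alpha> k M w n has_vector_derivative
      green_deriv l \<alpha> k M w (Suc n) x + (if n = 3 then of_real (\<alpha> ^ 4 / k) * w x else 0)) (at x within S)"
proof -
  let ?e = "\<lambda>q x. exp (om q * of_real \<alpha> * of_real x)"
  have "(green_deriv l \<alpha> k M w n has_vector_derivative
      (\<Sum>q\<in>UNIV. (om q * of_real \<alpha>) ^ n * ?e q x *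
         (- of_real (\<alpha> / (4 * k)) * (om q * (exp (- om q * of_real \<alpha> * of_real x) * w x))) +
        (om q * of_real \<alpha>) ^ n * (om q * of_real \<alpha> * ?e q x) * green_coeff l \<alpha> k M w x $ q)) (at x within S)"
    unfolding green_deriv_def
    by (intro has_vector_derivative_sum has_vector_derivative_mult has_vector_derivative_mult_right
        has_vector_derivative_cexp green_coeff_has_vector_derivative assms)
  also have "(\<Sum>q\<in>UNIV. (om q * of_real \<alpha>) ^ n * ?e q x *
         (- of_real (\<alpha> / (4 * k)) * (om q * (exp (- om q * of_real \<alpha> * of_real x) * w x))) +
        (om q * of_real \<alpha>) ^ n * (om q * of_real \<alpha> * ?e q x) * green_coeff l \<alpha> k M w x $ q)
     = green_deriv l \<alpha> k M w (Suc n) x +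
       (\<Sum>q\<in>UNIV. (om q * of_real \<alpha>) ^ n * ?e q x *
         (- of_real (\<alpha> / (4 * k)) * (om q * (exp (- om q * of_real \<alpha> * of_real x) * w x))))"
    by (simp add: green_deriv_def sum.distrib sum_negf sum_subtractf mult_ac)
  also have "(\<Sum>q\<in>UNIV. (om q * of_real \<alpha>) ^ n * ?e q x *
         (- of_real (\<alpha> / (4 * k)) * (om q * (exp (- om q * of_real \<alpha> * of_real x) * w x))))
     = - of_real (\<alpha> ^ Suc n / (4 * k)) * w x * (\<Sum>q\<in>UNIV. om q ^ Suc n)"
    unfolding sum_distrib_left
    by (rule sum.cong) (auto simp: exp_minus power_mult_distrib field_simps)
  also have "\<dots> = (if n = 3 then of_real (\<alpha> ^ 4 / k) * w x else 0)"
  proof (cases "n = 3")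
    case True
    then have "(\<Sum>q\<in>UNIV. om q ^ Suc n) = -4"
      by (simp add: sum_4 del: power_Suc)
    then show ?thesis
      using True by simp
  next
    case False
    then have "(\<Sum>q\<in>UNIV. om q ^ Suc n) = 0"
      using n by (intro sum_om_power) auto
    then show ?thesis
      using False by simp
  qed
  finally show ?thesis .
qed

text \<open>K w = 0 is differentiated repeatedly from the right. Each step holds off a null set, and
  continuity of the next \<open>green_deriv\<close> extends the vanishing to the whole interval. At
  n = 3 the jump term isolates w.\<close>

lemma K_op_injective:
  assumes M: "invertible (Mtilde l \<alpha> M)" and "l > 0" "\<alpha> > 0" "k > 0"
    and w: "integrable (lebesgue_on {-l..l}) w"
    and K: "AE x in lebesgue_on {-l..l}. K_op l \<alpha> k M w x = 0"
  shows "AE x in lebesgue_on {-l..l}. w x = 0"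
proof -
  let ?u = "green_deriv l \<alpha> k M w"
  define D where "D q N \<longleftrightarrow> negligible N \<and> (\<forall>x\<in>{-l..<l} - N.
     ((\<lambda>y. integral {-l..y} (\<lambda>\<xi>. exp (- om q * of_real \<alpha> * of_real \<xi>) * w \<xi>)) has_vector_derivative
      exp (- om q * of_real \<alpha> * of_real x) * w x) (at x within {x..l}))" for q N
  have "\<exists>N. D q N" for q
    unfolding D_def
    by (rule indefinite_integral_right_derivative[OF integrable_on_exp_mult[OF w, of "- om q * of_real \<alpha>"]]) blast
  then obtain N where N: "\<And>q. D q (N q)"
    by metis
  \<comment> \<open>The four exceptional sets are united; l joins them because {x..l} is a single
    point there.\<close>
  define N0 where "N0 = insert l (\<Union>q. N q)"
  have N0: "negligible N0"
    using N by (auto simp: N0_def D_def intro!: negligible_Union)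
  have deriv: "(?u n has_vector_derivative
      ?u (Suc n) x + (if n = 3 then of_real (\<alpha> ^ 4 / k) * w x else 0)) (at x within {x..l})"
    if "x \<in> {-l..l} - N0" "n < 4" for n x
    using that N by (intro green_deriv_has_vector_derivative) (auto simp: N0_def D_def)
  have next_zero: "?u (Suc n) x + (if n = 3 then of_real (\<alpha> ^ 4 / k) * w x else 0) = 0"
    if x: "x \<in> {-l..l} - N0" and n: "n < 4" and 0: "\<And>y. y \<in> {-l..l} \<Longrightarrow> ?u n y = 0" for n x
  proof (rule vector_derivative_unique_within[OF _ deriv[OF x n]])
    have "x < l"
      using x by (auto simp: N0_def)
    then show "at x within {x..l} \<noteq> bot"
      by (simp add: at_within_Icc_at_right trivial_limit_at_right_real)
    show "(?u n has_vector_derivative 0) (at x within {x..l})"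
      using x 0 by (intro has_vector_derivative_transform[OF _ _ has_vector_derivative_const[of 0]]) auto
  qed
  have zero: "\<forall>x\<in>{-l..l}. ?u n x = 0" if "n < 4" for n
    using that
  proof (induction n)
    case 0
    obtain N1 where "negligible N1" "\<And>x. x \<in> {-l..l} - N1 \<Longrightarrow> K_op l \<alpha> k M w x = 0"
      using K by (auto simp: AE_lebesgue_on_iff_negligible)
    then show ?case
      using continuous_negligible_imp_zero[OF continuous_on_green_deriv[OF w], of N1] \<open>l > 0\<close>
        K_op_eq_green_deriv[OF M w] by force
  next
    case (Suc n)
    then have "?u (Suc n) x = 0" if "x \<in> {-l..l} - N0" for x
      using next_zero[OF that, of n] by auto
    then show ?case
      using continuous_negligible_imp_zero[OF continuous_on_green_deriv[OF w] _ N0] \<open>l > 0\<close> by auto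
  qed
  have "w x = 0" if x: "x \<in> {-l..l} - N0" for x
    \<comment> \<open>For n = 3 the vanishing sum is \<open>green_deriv\<close> of order 4, a
      multiple of that of order 0 and so 0, plus a nonzero multiple of w.\<close>
    using next_zero[OF x, of 3] zero[of 3] zero[of 0] x green_deriv_4[of l \<alpha> k M w x] assms(3,4) by simp
  then show ?thesis
    using N0 by (auto simp: AE_lebesgue_on_iff_negligible)
qed

subsection \<open>Eigenfunctions and the boundary value problem\<close>

lemma matrix_vector_mult_smult: "A *v (s *s v) = s *s (A *v v)" for A :: "complex ^ 'n ^ 'm"
  by (simp add: vec_eq_iff matrix_vector_mult_def sum_distrib_left mult.left_commute)

text \<open>K w satisfies the boundary conditions: its jets at -l and l are \<open>Wmat\<close>
  times the coefficients. These are T P and T P - P, and \<open>Mtilde ** T = Mtilde_plus\<close>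
  makes the sum vanish.\<close>

lemma green_coeff_boundary:
  assumes M: "invertible (Mtilde l \<alpha> M)"
  shows "Mtilde_minus l \<alpha> M *v green_coeff l \<alpha> k M w (- l) + Mtilde_plus l \<alpha> M *v green_coeff l \<alpha> k M w l = 0"
proof -
  define a :: "complex ^ 4" where
    "a = of_real (\<alpha> / (4 * k)) *s (\<chi> r. integral {-l..l} (\<lambda>\<xi>. exp (om r * of_real \<alpha> * of_real \<xi>) * w \<xi>))"
  define P where "P = (Omega ** Lsq) *v a"
  define T where "T = matrix_inv (Mtilde l \<alpha> M) ** Mtilde_plus l \<alpha> M"
  have l: "green_coeff l \<alpha> k M w (- l) = T *v P"
  proof -
    have "green_coeff l \<alpha> k M w (- l) = G_plus l \<alpha> M *v a"
      by (simp add: vec_eq_iff green_coeff_def a_def matrix_vector_mult_def sum_distrib_left mult.left_commute)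
    also have "\<dots> = T *v P"
      by (simp add: T_def P_def G_plus_def matrix_vector_mul_assoc matrix_mul_assoc)
    finally show ?thesis .
  qed
  \<comment> \<open>Because \<open>om (q + 2) = - om q\<close>, P collects, with their factors, the
    Volterra integrals over the full interval, so the coefficients change by - P from -l to
    l.\<close>
  have "P $ q = om q * a $ (q + 2)" for q
    by (simp add: P_def matrix_vector_mult_def Omega_Lsq_nth if_distrib[of "\<lambda>a. a * _"] cong: if_cong)
  then have r: "green_coeff l \<alpha> k M w l = T *v P - P"
    unfolding l[symmetric]
    by (simp add: vec_eq_iff green_coeff_def a_def om_add_2 algebra_simps)
  have "Mtilde_minus l \<alpha> M *v (T *v P) + Mtilde_plus l \<alpha> M *v (T *v P) = Mtilde l \<alpha> M *v (T *v P)"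
    by (simp add: Mtilde_def matrix_vector_mult_add_rdistrib)
  also have "\<dots> = (Mtilde l \<alpha> M ** matrix_inv (Mtilde l \<alpha> M)) *v (Mtilde_plus l \<alpha> M *v P)"
    by (simp add: T_def matrix_vector_mul_assoc matrix_mul_assoc)
  also have "\<dots> = Mtilde_plus l \<alpha> M *v P"
    by (simp add: matrix_inv_right[OF M])
  finally show ?thesis
    unfolding l r by (simp add: matrix_vector_mult_diff_distrib algebra_simps)
qed

text \<open>With d the coordinates of u in the exponentials, \<mu> d and the coefficients of K u
  have the same increments, so they differ by a constant e. Both satisfy the boundary conditions,
  hence \<open>Mtilde\<close> kills e, and e = 0.\<close>

lemma K_op_eigenfunction:
  assumes M: "invertible (Mtilde l \<alpha> M)" and pos: "l > 0" "\<alpha> > 0" "k > 0" "\<mu> \<noteq> 0"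
    and u: "deriv_chain {-l..l} u"
    and u4: "\<And>x. x \<in> {-l..l} \<Longrightarrow> u 4 x = - (of_real \<alpha> ^ 4 * (1 - 1 / (\<mu> * of_real k))) * u 0 x"
    and bc: "left_block M *v jet u (- l) + right_block M *v jet u l = 0"
    and w: "integrable (lebesgue_on {-l..l}) (u 0)"
    and x: "x \<in> {-l..l}"
  shows "K_op l \<alpha> k M (u 0) x = \<mu> * u 0 x"
proof -
  let ?c = "green_coeff l \<alpha> k M (u 0)"
  define d where "d t = expW_inv (of_real \<alpha>) t *v jet u t" for t
  have a: "complex_of_real \<alpha> \<noteq> 0"
    using pos by simp
  have W: "Wmat \<alpha> t *v d t = jet u t" for t
    using expW_inv_mult[OF a, of t] by (simp add: d_def Wmat_eq matrix_vector_mul_assoc matrix_left_right_inverse)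
  have diff: "\<mu> *s d t - \<mu> *s d (- l) = ?c t - ?c (- l)" if t: "t \<in> {-l..l}" for t
  proof -
    have "\<mu> * (d t $ q - d (- l) $ q) = ?c t $ q - ?c (- l) $ q" for q
    proof -
      let ?I = "integral {-l..t} (\<lambda>\<xi>. exp (- om q * of_real \<alpha> * of_real \<xi>) * u 0 \<xi>)"
      let ?f = "\<lambda>\<xi>. - om q / (4 * of_real \<alpha> ^ 3) * exp (- om q * of_real \<alpha> * of_real \<xi>) * (u 4 \<xi> + of_real \<alpha> ^ 4 * u 0 \<xi>)"
      let ?g = "\<lambda>\<xi>. - om q * of_real \<alpha> / (4 * \<mu> * of_real k) * (exp (- om q * of_real \<alpha> * of_real \<xi>) * u 0 \<xi>)"
      have "((\<lambda>s. d s $ q) has_vector_derivative ?f s) (at s within {-l..t})" if "s \<in> {-l..t}" for s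
        unfolding d_def
        by (rule has_vector_derivative_within_subset[OF variation_of_constants[OF u _ a]]) (use t that in auto)
      then have "(?f has_integral (d t $ q - d (- l) $ q)) {-l..t}"
        using t by (intro fundamental_theorem_of_calculus) auto
      moreover have "?f \<xi> = ?g \<xi>" if "\<xi> \<in> {-l..t}" for \<xi>
      proof -
        have "u 4 \<xi> + of_real \<alpha> ^ 4 * u 0 \<xi> = of_real \<alpha> ^ 3 * of_real \<alpha> / (\<mu> * of_real k) * u 0 \<xi>"
          using t that pos u4[of \<xi>] by (simp add: algebra_simps power4_eq_xxxx power3_eq_cube)
        then show ?thesis
          using a pos by (simp only:) (simp add: field_simps)
      qed
      ultimately have "(?g has_integral (d t $ q - d (- l) $ q)) {-l..t}"
        by (rule has_integral_eq[rotated])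
      then have "d t $ q - d (- l) $ q = integral {-l..t} ?g"
        by (rule integral_unique[symmetric])
      also have "\<dots> = - om q * of_real \<alpha> / (4 * \<mu> * of_real k) * ?I"
        by (rule integral_mult_right)
      finally show ?thesis
        using pos by (simp add: green_coeff_def field_simps)
    qed
    then show ?thesis
      by (simp add: vec_eq_iff right_diff_distrib)
  qed
  define e where "e = \<mu> *s d (- l) - ?c (- l)"
  have c: "\<mu> *s d t = ?c t + e" if "t \<in> {-l..l}" for t
    using diff[OF that] by (simp add: e_def algebra_simps)
  have "0 = \<mu> *s (left_block M *v jet u (- l) + right_block M *v jet u l)"
    by (simp add: bc)
  also have "\<dots> = Mtilde_minus l \<alpha> M *v (\<mu> *s d (- l)) + Mtilde_plus l \<alpha> M *v (\<mu> *s d l)"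
    by (simp add: matrix_vector_mult_smult Mtilde_minus_def Mtilde_plus_def W flip: matrix_vector_mul_assoc vector_add_ldistrib)
  also have "\<dots> = Mtilde_minus l \<alpha> M *v (?c (- l) + e) + Mtilde_plus l \<alpha> M *v (?c l + e)"
    using c[of l] c[of "- l"] pos by simp
  also have "\<dots> = (Mtilde_minus l \<alpha> M *v ?c (- l) + Mtilde_plus l \<alpha> M *v ?c l) + Mtilde l \<alpha> M *v e"
    by (simp add: Mtilde_def matrix_vector_right_distrib matrix_vector_mult_add_rdistrib)
  finally have "Mtilde l \<alpha> M *v e = 0"
    by (simp add: green_coeff_boundary[OF M])
  then have "e = 0"
    using matrix_inv_left[OF M] by (metis matrix_vector_mul_assoc matrix_vector_mul_lid matrix_vector_mult_0_right)
  then have "?c x = \<mu> *s d x"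
    using c[OF x] by simp
  \<comment> \<open>Row 1 of \<open>Wmat\<close> consists of the plain exponentials, so this entry
    recovers the function itself.\<close>
  then have "K_op l \<alpha> k M (u 0) x = \<mu> * (Wmat \<alpha> x *v d x) $ 1"
    by (simp add: K_op_eq[OF M w x] Wmat_def matrix_vector_mult_def sum_distrib_left mult.left_commute)
  then show ?thesis
    by (simp add: W jet_def)
qed

text \<open>w is determined only up to a null set. Its continuous representative v = K w / \<mu>
  gives the same integrals, and K v = \<mu> v then yields four derivatives.\<close>

lemma eigenfunction_deriv_chain:
  assumes M: "invertible (Mtilde l \<alpha> M)" and \<mu>: "\<mu> \<noteq> 0" and k: "k > 0"
    and w: "integrable (lebesgue_on {-l..l}) w"
    and K: "AE x in lebesgue_on {-l..l}. K_op l \<alpha> k M w x = \<mu> * w x"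
  obtains u where "deriv_chain {-l..l} u"
    "\<And>x. x \<in> {-l..l} \<Longrightarrow> u 4 x = - (of_real \<alpha> ^ 4 * (1 - 1 / (\<mu> * of_real k))) * u 0 x"
    "left_block M *v jet u (- l) + right_block M *v jet u l = 0"
    "AE x in lebesgue_on {-l..l}. \<mu> * w x = u 0 x"
proof -
  define v where "v x = green_deriv l \<alpha> k M w 0 x / \<mu>" for x
  obtain N where N: "negligible N" "\<And>x. x \<in> {-l..l} - N \<Longrightarrow> K_op l \<alpha> k M w x = \<mu> * w x"
    using K by (auto simp: AE_lebesgue_on_iff_negligible)
  have wv: "w x = v x" if "x \<in> {-l..l} - N" for x
    using K_op_eq_green_deriv[OF M w, of x k] N(2)[OF that] that \<mu> by (simp add: v_def eq_divide_eq mult.commute)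
  have int: "integral {-l..x} (\<lambda>\<xi>. exp (c * of_real \<xi>) * v \<xi>) = integral {-l..x} (\<lambda>\<xi>. exp (c * of_real \<xi>) * w \<xi>)"
    if "x \<le> l" for c x
    using that wv by (intro integral_spike[OF N(1)]) auto
  have coeff: "green_coeff l \<alpha> k M v x = green_coeff l \<alpha> k M w x" if "x \<le> l" for x
    by (simp only: green_coeff_def int[OF order_refl] int[OF that])
  have gv: "green_deriv l \<alpha> k M v n x = green_deriv l \<alpha> k M w n x" if "x \<le> l" for n x
    using coeff[OF that] by (simp add: green_deriv_def)
  have cont: "continuous_on {-l..l} v"
    unfolding v_def by (intro continuous_intros continuous_on_green_deriv[OF w]) (simp add: \<mu>)
  \<comment> \<open>At n = 4 the jump term is added to make this the true fourth derivative. On the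
    interval the sequence is \<mu> times that of v, since \<open>u 0\<close> is K v.\<close>
  define u where "u n x = green_deriv l \<alpha> k M v n x + (if n = 4 then of_real (\<alpha> ^ 4 / k) * v x else 0)" for n x
  have "deriv_chain {-l..l} u"
    unfolding deriv_chain_def
  proof (intro allI impI ballI)
    fix n :: nat and x assume n: "n < 4" and x: "x \<in> {-l..l}"
    have "(green_deriv l \<alpha> k M v n has_vector_derivative
      green_deriv l \<alpha> k M v (Suc n) x + (if n = 3 then of_real (\<alpha> ^ 4 / k) * v x else 0)) (at x within {-l..l})"
      by (intro green_deriv_has_vector_derivative n integral_has_vector_derivative continuous_intros cont x)
    moreover have "u n = green_deriv l \<alpha> k M v n"
      using n by (auto simp: u_def)
    ultimately show "(u n has_vector_derivative u (Suc n) x) (at x within {-l..l})"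
      by (simp add: u_def)
  qed
  moreover have "u 4 x = - (of_real \<alpha> ^ 4 * (1 - 1 / (\<mu> * of_real k))) * u 0 x" if "x \<in> {-l..l}" for x
    using gv[of x 0] that \<mu> k by (simp add: u_def green_deriv_4 v_def field_simps)
  moreover have "jet u = jet (green_deriv l \<alpha> k M v)"
    by (simp add: fun_eq_iff vec_eq_iff forall_4 jet_def u_def)
  then have "left_block M *v jet u (- l) + right_block M *v jet u l = 0"
    using green_coeff_boundary[OF M, of k v]
    by (simp add: jet_green_deriv matrix_vector_mul_assoc Mtilde_minus_def Mtilde_plus_def)
  moreover have "AE x in lebesgue_on {-l..l}. \<mu> * w x = u 0 x"
  proof -
    have "\<mu> * w x = u 0 x" if "x \<in> {-l..l} - N" for x
      using wv[OF that] gv[of x 0] that \<mu> by (simp add: u_def v_def)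
    then show ?thesis
      using N(1) by (auto simp: AE_lebesgue_on_iff_negligible)
  qed
  ultimately show ?thesis ..
qed

section \<open>Kernels, derivative sequences and well-posedness\<close>

lemma invertible_iff_kernel:
  fixes A :: "complex ^ 'n ^ 'n"
  shows "invertible A \<longleftrightarrow> (\<forall>v. A *v v = 0 \<longrightarrow> v = 0)"
  unfolding invertible_left_inverse by (rule matrix_left_invertible_ker)

lemma det_eq_0_iff_kernel:
  fixes A :: "complex ^ 'n ^ 'n"
  shows "det A = 0 \<longleftrightarrow> (\<exists>v. v \<noteq> 0 \<and> A *v v = 0)"
proof -
  have "det A = 0 \<longleftrightarrow> \<not> invertible A"
    by (simp add: invertible_det_nz)
  then show ?thesis
    unfolding invertible_iff_kernel by blast
qed

lemma deriv_chain_nth_derivative: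
  assumes u: "deriv_chain {a..b} u" and "a < b" and "n \<le> 4" and "x \<in> {a..b}"
  shows "nth_derivative {a..b} n (u 0) x = u n x"
  using assms(3,4)
proof (induction n arbitrary: x)
  case (Suc n)
  have "(u n has_vector_derivative u (Suc n) x) (at x within {a..b})"
    using u Suc.prems by (auto simp: deriv_chain_def)
  then have "(nth_derivative {a..b} n (u 0) has_vector_derivative u (Suc n) x) (at x within {a..b})"
    by (rule has_vector_derivative_transform[OF Suc.prems(2), rotated])
      (use Suc.prems(1) in \<open>simp add: Suc.IH\<close>)
  then show ?case
    unfolding nth_derivative_Suc
    by (rule vector_derivative_within_cbox[of a b x, unfolded box_real, OF \<open>a < b\<close> Suc.prems(2)])
qed simp

lemma deriv_chain_nth_derivative_has_vector_derivative:
  assumes u: "deriv_chain {a..b} u" and "a < b" and "n < 4" and x: "x \<in> {a..b}"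
  shows "(nth_derivative {a..b} n (u 0) has_vector_derivative u (Suc n) x) (at x within {a..b})"
proof (rule has_vector_derivative_transform[OF x])
  show "(u n has_vector_derivative u (Suc n) x) (at x within {a..b})"
    using assms by (auto simp: deriv_chain_def)
qed (use \<open>n < 4\<close> in \<open>simp add: deriv_chain_nth_derivative[OF u \<open>a < b\<close>]\<close>)

lemma deriv_chain_continuous_on:
  assumes "deriv_chain S u" "n < 4"
  shows "continuous_on S (u n)"
proof -
  have "continuous (at x within S) (u n)" if "x \<in> S" for x
    using assms that unfolding deriv_chain_def by (blast intro: has_vector_derivative_continuous)
  then show ?thesis
    by (simp add: continuous_on_eq_continuous_within)
qed

lemma deriv_chain_zero:
  assumes u: "deriv_chain {a..b} u" and "a < b" and 0: "\<And>x. x \<in> {a..b} \<Longrightarrow> u 0 x = 0" and x: "x \<in> {a..b}"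
  shows "jet u x = 0"
proof -
  have "\<forall>x\<in>{a..b}. u n x = 0" if "n \<le> 4" for n
    using that
  proof (induction n)
    case (Suc n)
    show ?case
    proof
      fix x
      assume x: "x \<in> {a..b}"
      have "(u n has_vector_derivative u (Suc n) x) (at x within {a..b})"
        using u Suc.prems x by (auto simp: deriv_chain_def)
      moreover have "(u n has_vector_derivative 0) (at x within {a..b})"
        using Suc by (intro has_vector_derivative_transform[OF x _ has_vector_derivative_const[of 0]]) auto
      ultimately show "u (Suc n) x = 0"
        using vector_derivative_unique_within_closed_interval[of a b x] \<open>a < b\<close> x by auto
    qed
  qed (use 0 in auto)
  then show ?thesis
    using x by (auto simp: vec_eq_iff jet_def forall_4)
qed

lemma boundary_values_deriv_chain:
  assumes u: "deriv_chain {-l..l} u" and "l > 0"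
  shows "M *v boundary_values l (u 0) = left_block M *v jet u (- l) + right_block M *v jet u l"
proof -
  have "nth_derivative {-l..l} n (u 0) x = u n x" if "n < 4" "x = -l \<or> x = l" for n x
    using that \<open>l > 0\<close> by (intro deriv_chain_nth_derivative[OF u]) auto
  then show ?thesis
    by (simp add: vec_eq_iff matrix_vector_mult_def sum_8 sum_4 boundary_values_def left_block_def right_block_def jet_def)
qed

text \<open>A kernel vector c gives a combination of exponentials that solves the beam equation with
  the boundary conditions. Well-posedness makes it zero, and then its jet at l,
  \<open>Wmat \<alpha> l *v c\<close>, forces c = 0.\<close>

lemma wp_imp_invertible_Mtilde:
  assumes M: "M \<in> wp l \<alpha>" and "l > 0" "\<alpha> > 0"
  shows "invertible (Mtilde l \<alpha> M)"
proof -
  have "c = 0" if c: "Mtilde l \<alpha> M *v c = 0" for c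
  proof -
    define u where "u n x = (\<Sum>q\<in>UNIV. (om q * of_real \<alpha>) ^ n * exp (om q * of_real \<alpha> * of_real x) * c $ q)" for n x
    have du: "(u n has_vector_derivative u (Suc n) x) (at x within S)" for n x S
    proof -
      have "(u n has_vector_derivative (\<Sum>q\<in>UNIV. (om q * of_real \<alpha>) ^ n *
          (om q * of_real \<alpha> * exp (om q * of_real \<alpha> * of_real x)) * c $ q)) (at x within S)"
        unfolding u_def
        by (intro has_vector_derivative_sum has_vector_derivative_mult_left has_vector_derivative_mult_right has_vector_derivative_cexp)
      then show ?thesis
        by (simp add: u_def mult_ac)
    qed
    have chain: "deriv_chain {-l..l} u"
      by (simp add: deriv_chain_def du)
    have jet: "jet u x = Wmat \<alpha> x *v c" for x
      by (simp add: jet_def u_def Wmat_def matrix_vector_mult_def)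
    have ll: "- l < l"
      using \<open>l > 0\<close> by simp
    have "beam_solution l \<alpha> (u 0)"
      unfolding beam_solution_def
    proof (intro conjI allI impI ballI)
      fix n :: nat and x assume "n < 4" "x \<in> {-l..l}"
      then show "nth_derivative {-l..l} n (u 0) differentiable (at x within {-l..l})"
        using deriv_chain_nth_derivative_has_vector_derivative[OF chain ll] by (blast intro: differentiableI_vector)
    next
      fix x assume "x \<in> {-l..l}"
      then show "nth_derivative {-l..l} 4 (u 0) x + of_real (\<alpha> ^ 4) * u 0 x = 0"
        by (simp add: deriv_chain_nth_derivative[OF chain ll])
          (simp add: u_def power_mult_distrib sum_distrib_left sum_negf mult.assoc)
    qed
    moreover have "M *v boundary_values l (u 0) = 0"
      using c unfolding boundary_values_deriv_chain[OF chain \<open>l > 0\<close>] jet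
      by (simp add: Mtilde_def Mtilde_minus_def Mtilde_plus_def matrix_vector_mul_assoc matrix_vector_mult_add_rdistrib)
    ultimately have "u 0 x = 0" if "x \<in> {-l..l}" for x
      using M that by (auto simp: wp_def)
    then have "Wmat \<alpha> l *v c = 0"
      using deriv_chain_zero[OF chain ll, of l] ll by (simp add: jet)
    moreover have "invertible (Wmat \<alpha> l)"
      using \<open>\<alpha> > 0\<close> by (simp add: Wmat_eq invertible_expW)
    ultimately show ?thesis
      unfolding invertible_iff_kernel by blast
  qed
  then show ?thesis
    unfolding invertible_iff_kernel by blast
qed

section \<open>Square-integrable functions and eigenvalues\<close>

lemma L2_imp_integrable:
  assumes "w \<in> L2 l"
  shows "integrable (lebesgue_on {-l..l}) w"
proof -
  interpret finite_measure "lebesgue_on {-l..l}"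
    by (rule finite_measure_lebesgue_on) simp
  show ?thesis
  proof (rule Bochner_Integration.integrable_bound)
    show "integrable (lebesgue_on {-l..l}) (\<lambda>x. 1 + (cmod (w x))\<^sup>2)"
      using assms by (auto simp: L2_def)
    show "w \<in> borel_measurable (lebesgue_on {-l..l})"
      using assms by (simp add: L2_def)
    \<comment> \<open>From (t - 1/2)^2 \<ge> 0; it bounds |w| by 1 + |w|^2, which is integrable on
      the finite interval.\<close>
    have "t \<le> \<bar>1 + t\<^sup>2\<bar>" for t :: real
      using sum_squares_ge_zero[of "t - 1/2" 0] by (simp add: power2_eq_square algebra_simps)
    then show "AE x in lebesgue_on {-l..l}. norm (w x) \<le> norm (1 + (cmod (w x))\<^sup>2)"
      by simp
  qed
qed

lemma continuous_imp_L2: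
  assumes "continuous_on {-l..l} w"
  shows "w \<in> L2 l"
proof -
  have "continuous_on {-l..l} (\<lambda>x. (cmod (w x))\<^sup>2)"
    by (intro continuous_intros assms)
  then have "(\<lambda>x. (cmod (w x))\<^sup>2) absolutely_integrable_on {-l..l}"
    by (rule absolutely_integrable_continuous_real)
  then have "integrable (lebesgue_on {-l..l}) (\<lambda>x. (cmod (w x))\<^sup>2)"
    by (simp add: integrable_restrict_space set_integrable_def)
  moreover have "w \<in> borel_measurable (lebesgue_on {-l..l})"
    by (intro continuous_imp_measurable_on_sets_lebesgue assms) simp
  ultimately show ?thesis
    by (simp add: L2_def)
qed

lemma zero_notin_Spec_K_op:
  assumes "invertible (Mtilde l \<alpha> M)" "l > 0" "\<alpha> > 0" "k > 0"
  shows "0 \<notin> Spec l (K_op l \<alpha> k M)"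
proof
  assume "0 \<in> Spec l (K_op l \<alpha> k M)"
  then obtain w where w: "w \<in> L2 l" "\<not> (AE x in lebesgue_on {-l..l}. w x = 0)"
    "AE x in lebesgue_on {-l..l}. K_op l \<alpha> k M w x = 0"
    by (auto simp: Spec_def)
  then show False
    using K_op_injective[OF assms L2_imp_integrable[OF w(1)] w(3)] by simp
qed

text \<open>A kernel vector lists the coefficients of an eigenfunction in the columns of
  \<open>Wlam\<close>. By continuity and invertibility of \<open>Wlam\<close>, nonzero vectors match
  functions that are not zero almost everywhere.\<close>

lemma Spec_K_op_iff:
  assumes M: "invertible (Mtilde l \<alpha> M)" and pos: "l > 0" "\<alpha> > 0" "k > 0" and \<mu>: "\<mu> \<noteq> 0"
  shows "\<mu> \<in> Spec l (K_op l \<alpha> k M) \<longleftrightarrow>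
    det (left_block M ** Wlam \<alpha> k \<mu> (- l) + right_block M ** Wlam \<alpha> k \<mu> l) = 0" (is "_ \<longleftrightarrow> det ?A = 0")
proof -
  have nz: "k \<noteq> 0" "\<alpha> \<noteq> 0" and ll: "- l < l"
    using pos by auto
  have A: "?A *v b = left_block M *v (Wlam \<alpha> k \<mu> (- l) *v b) + right_block M *v (Wlam \<alpha> k \<mu> l *v b)" for b
    by (simp add: matrix_vector_mul_assoc matrix_vector_mult_add_rdistrib)
  show ?thesis
    unfolding det_eq_0_iff_kernel
  proof
    assume "\<mu> \<in> Spec l (K_op l \<alpha> k M)"
    then obtain w where w: "w \<in> L2 l" "\<not> (AE x in lebesgue_on {-l..l}. w x = 0)"
      "AE x in lebesgue_on {-l..l}. K_op l \<alpha> k M w x = \<mu> * w x"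
      by (auto simp: Spec_def)
    obtain u where u: "deriv_chain {-l..l} u"
      "\<And>x. x \<in> {-l..l} \<Longrightarrow> u 4 x = - (of_real \<alpha> ^ 4 * (1 - 1 / (\<mu> * of_real k))) * u 0 x"
      "left_block M *v jet u (- l) + right_block M *v jet u l = 0"
      "AE x in lebesgue_on {-l..l}. \<mu> * w x = u 0 x"
      by (rule eigenfunction_deriv_chain[OF M \<mu> pos(3) L2_imp_integrable[OF w(1)] w(3)]) (rule that)
    obtain b where b: "\<And>x. x \<in> {-l..l} \<Longrightarrow> jet u x = Wlam \<alpha> k \<mu> x *v b"
      by (rule jet_eq_Wlam[OF \<mu> nz u(1,2)]) (assumption, rule that)
    have "?A *v b = 0"
      using u(3) b[of l] b[of "- l"] ll by (simp add: A)
    moreover have "b \<noteq> 0"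
    proof
      assume "b = 0"
      then have "jet u x = 0" if "x \<in> {-l..l}" for x
        using b[OF that] by simp
      then have "u 0 x = 0" if "x \<in> {-l..l}" for x
        using that by (simp add: jet_def vec_eq_iff forall_4)
      then have "AE x in lebesgue_on {-l..l}. w x = 0"
        using u(4) \<mu> by (auto simp: AE_lebesgue_on_iff_negligible)
      with w(2) show False ..
    qed
    ultimately show "\<exists>v. v \<noteq> 0 \<and> ?A *v v = 0"
      by blast
  next
    assume "\<exists>v. v \<noteq> 0 \<and> ?A *v v = 0"
    then obtain b where b: "b \<noteq> 0" "?A *v b = 0"
      by blast
    let ?u = "lam_solution \<alpha> k \<mu> b"
    have chain: "deriv_chain {-l..l} ?u"
      by (rule deriv_chain_lam_solution)
    have cont: "continuous_on {-l..l} (?u 0)"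
      by (rule deriv_chain_continuous_on[OF chain]) simp
    have L2: "?u 0 \<in> L2 l"
      by (rule continuous_imp_L2[OF cont])
    have "K_op l \<alpha> k M (?u 0) x = \<mu> * ?u 0 x" if "x \<in> {-l..l}" for x
      by (rule K_op_eigenfunction[OF M pos \<mu> chain _ _ L2_imp_integrable[OF L2] that])
        (simp_all add: lam_solution_4[OF \<mu> nz(1)] jet_lam_solution b(2) flip: A)
    moreover have "\<not> (AE x in lebesgue_on {-l..l}. ?u 0 x = 0)"
    proof
      assume "AE x in lebesgue_on {-l..l}. ?u 0 x = 0"
      then obtain N where "negligible N" "\<And>x. x \<in> {-l..l} - N \<Longrightarrow> ?u 0 x = 0"
        by (auto simp: AE_lebesgue_on_iff_negligible)
      then have "?u 0 x = 0" if "x \<in> {-l..l}" for x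
        using continuous_negligible_imp_zero[OF cont ll] that by blast
      then have "Wlam \<alpha> k \<mu> l *v b = 0"
        using deriv_chain_zero[OF chain ll, of l] ll by (simp add: jet_lam_solution)
      moreover obtain R where "R ** Wlam \<alpha> k \<mu> l = mat 1"
        by (rule Wlam_fundamental[OF \<mu> nz]) (rule that)
      ultimately show False
        using b(1) by (metis matrix_vector_mul_assoc matrix_vector_mul_lid matrix_vector_mult_0_right)
    qed
    ultimately show "\<mu> \<in> Spec l (K_op l \<alpha> k M)"
      unfolding Spec_def using L2 by (intro CollectI bexI[of _ "?u 0"] conjI AE_I2) auto
  qed
qed

subsection \<open>The boundary conditions \<open>Qmat\<close>\<close>

lemma matrix_diff_ldistrib: "A ** (B - C) = A ** B - A ** C"
  and matrix_diff_rdistrib: "(A' - B') ** C' = A' ** C' - B' ** C'"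
  and matrix_add_rdistrib: "(A' + B') ** C' = A' ** C' + B' ** C'"
  and matrix_minus_right: "A ** (- B) = - (A ** B)"
  for A A' B' :: "complex ^ 'n ^ 'm" and B C C' :: "complex ^ 'k ^ 'n"
  by (simp_all add: vec_eq_iff matrix_matrix_mult_def right_diff_distrib left_diff_distrib
      distrib_right sum_subtractf sum.distrib sum_negf)

lemma diag_mult_nth: "(diag v ** A) $ i $ j = v $ i * A $ i $ j"
  by (simp add: diag_def matrix_matrix_mult_def if_distrib[of "\<lambda>a. a * _"] cong: if_cong)

lemma mult_diag_nth: "(A ** diag v) $ i $ j = A $ i $ j * v $ j"
  by (simp add: diag_def matrix_matrix_mult_def if_distrib[of "\<lambda>a. _ * a"] cong: if_cong)

abbreviation "proj14 \<equiv> diag (vector [1, 0, 0, 1])"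
abbreviation "proj23 \<equiv> diag (vector [0, 1, 1, 0])"

text \<open>The left sides are the symbols of the rows of \<open>Qmat\<close> with \<alpha> scaled
  out. Those at -l vanish on the exponentials 1 and 4, which decay towards minus infinity; those at
  l vanish on 2 and 3, which decay towards plus infinity.\<close>

lemma om_cubics:
  fixes r :: complex
  defines "r \<equiv> of_real (sqrt 2)"
  shows "om q ^ 3 - r * om q ^ 2 + om q = (if q = 2 then 2 * \<i> * r else if q = 3 then - 2 * \<i> * r else 0)"
    and "om q ^ 3 - om q + r = (if q = 2 \<or> q = 3 then 2 * r else 0)"
    and "om q ^ 3 + r * om q ^ 2 + om q = (if q = 1 then 2 * \<i> * r else if q = 4 then - 2 * \<i> * r else 0)"
    and "om q ^ 3 - om q - r = (if q = 1 \<or> q = 4 then - 2 * r else 0)"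
proof -
  define c where "c = complex_of_real (sqrt 2 / 2)"
  have r: "r = 2 * c"
    by (simp add: r_def c_def)
  have 1: "omega 1 = c + \<i> * c"
    by (simp add: omega_1 c_def algebra_simps)
  have 2: "om 1 ^ 2 = \<i>" "om 2 ^ 2 = - \<i>" "om 3 ^ 2 = \<i>" "om 4 ^ 2 = - \<i>"
    by (simp_all add: omega_eqs power2_eq_square omega_1_sq algebra_simps)
  have 3: "om q ^ 3 = om q ^ 2 * om q" for q
    by (simp add: power2_eq_square power3_eq_cube)
  have 0: "om 1 = c + \<i> * c" "om 2 = - c + \<i> * c" "om 3 = - c - \<i> * c" "om 4 = c - \<i> * c"
    by (simp_all add: omega_eqs 1 algebra_simps)
  show "om q ^ 3 - r * om q ^ 2 + om q = (if q = 2 then 2 * \<i> * r else if q = 3 then - 2 * \<i> * r else 0)"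
    "om q ^ 3 - om q + r = (if q = 2 \<or> q = 3 then 2 * r else 0)"
    "om q ^ 3 + r * om q ^ 2 + om q = (if q = 1 then 2 * \<i> * r else if q = 4 then - 2 * \<i> * r else 0)"
    "om q ^ 3 - om q - r = (if q = 1 \<or> q = 4 then - 2 * r else 0)"
    unfolding 3 r using exhaust_4[of q]
    by (elim disjE; hypsubst; unfold 2; unfold 0; simp add: algebra_simps)+
qed

lemma Mtilde_Qmat_nth:
  fixes l \<alpha> :: real
  defines "r \<equiv> complex_of_real (sqrt 2)" and "a \<equiv> complex_of_real \<alpha>"
    and "e \<equiv> \<lambda>q x. exp (om q * of_real \<alpha> * of_real x)"
  shows "Mtilde_minus l \<alpha> (Qmat \<alpha>) $ 1 $ q = a ^ 3 * (om q ^ 3 - r * om q ^ 2 + om q) * e q (- l)"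
    "Mtilde_minus l \<alpha> (Qmat \<alpha>) $ 2 $ q = a ^ 3 * (om q ^ 3 - om q + r) * e q (- l)"
    "Mtilde_minus l \<alpha> (Qmat \<alpha>) $ 3 $ q = 0" "Mtilde_minus l \<alpha> (Qmat \<alpha>) $ 4 $ q = 0"
    "Mtilde_plus l \<alpha> (Qmat \<alpha>) $ 1 $ q = 0" "Mtilde_plus l \<alpha> (Qmat \<alpha>) $ 2 $ q = 0"
    "Mtilde_plus l \<alpha> (Qmat \<alpha>) $ 3 $ q = a ^ 3 * (om q ^ 3 + r * om q ^ 2 + om q) * e q l"
    "Mtilde_plus l \<alpha> (Qmat \<alpha>) $ 4 $ q = a ^ 3 * (om q ^ 3 - om q - r) * e q l"
  by (simp_all add: Mtilde_minus_def Mtilde_plus_def left_block_def right_block_def Qmat_def Let_def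
      matrix_matrix_mult_def sum_4 Wmat_def r_def a_def e_def power_mult_distrib)
    (simp_all add: algebra_simps power2_eq_square power3_eq_cube)

text \<open>By \<open>om_cubics\<close>, \<open>Mtilde_minus\<close> lives in columns 2 and 3 and
  \<open>Mtilde_plus\<close> in columns 1 and 4, so the projections separate the two in their
  sum.\<close>

lemma Mtilde_Qmat_proj:
  "Mtilde l \<alpha> (Qmat \<alpha>) ** proj23 = Mtilde_minus l \<alpha> (Qmat \<alpha>)"
  "Mtilde l \<alpha> (Qmat \<alpha>) ** proj14 = Mtilde_plus l \<alpha> (Qmat \<alpha>)"
  by (simp_all add: vec_eq_iff mult_diag_nth Mtilde_def forall_4 Mtilde_Qmat_nth om_cubics
      del: idx_simps One_nat_def)

text \<open>The system splits into two 2 by 2 systems, each consisting of the sum and the difference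
  of two unknowns up to nonzero factors.\<close>

lemma invertible_Mtilde_Qmat:
  assumes "\<alpha> \<noteq> 0"
  shows "invertible (Mtilde l \<alpha> (Qmat \<alpha>))"
proof -
  have "v = 0" if v: "Mtilde l \<alpha> (Qmat \<alpha>) *v v = 0" for v
  proof -
    define z where "z q x = exp (om q * of_real \<alpha> * of_real x) * v $ q" for q x
    define b where "b = 2 * complex_of_real (sqrt 2) * of_real \<alpha> ^ 3"
    have "b \<noteq> 0"
      using assms by (simp add: b_def)
    have i: "(Mtilde l \<alpha> (Qmat \<alpha>) *v v) $ i = 0" for i
      using v by simp
    have "(Mtilde l \<alpha> (Qmat \<alpha>) *v v) $ 1 = \<i> * b * (z 2 (- l) - z 3 (- l))"
      "(Mtilde l \<alpha> (Qmat \<alpha>) *v v) $ 2 = b * (z 2 (- l) + z 3 (- l))"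
      "(Mtilde l \<alpha> (Qmat \<alpha>) *v v) $ 3 = \<i> * b * (z 1 l - z 4 l)"
      "(Mtilde l \<alpha> (Qmat \<alpha>) *v v) $ 4 = - b * (z 1 l + z 4 l)"
      by (simp_all add: matrix_vector_mult_def sum_4 Mtilde_def Mtilde_Qmat_nth om_cubics z_def b_def
          del: idx_simps) (simp_all add: algebra_simps)
    note eqs = this[unfolded i]
    have "z 2 (- l) - z 3 (- l) = 0" "z 2 (- l) + z 3 (- l) = 0" "z 1 l - z 4 l = 0" "z 1 l + z 4 l = 0"
      using eqs \<open>b \<noteq> 0\<close> by simp_all
    then have "z 2 (- l) = 0" "z 3 (- l) = 0" "z 1 l = 0" "z 4 l = 0"
      by (auto simp: eq_neg_iff_add_eq_0)
    then show ?thesis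
      by (simp add: vec_eq_iff forall_4 z_def)
  qed
  then show ?thesis
    unfolding invertible_iff_kernel by blast
qed

section \<open>Characteristic matrices and the determinant identity\<close>

lemma characteristic_matrix_eq:
  assumes "\<alpha> \<noteq> 0"
  shows "left_block M ** Wlam \<alpha> k \<mu> (- l) + right_block M ** Wlam \<alpha> k \<mu> l =
    Mtilde_minus l \<alpha> M ** (matrix_inv (Wmat \<alpha> (- l)) ** Wlam \<alpha> k \<mu> (- l)) +
    Mtilde_plus l \<alpha> M ** (matrix_inv (Wmat \<alpha> l) ** Wlam \<alpha> k \<mu> l)"
proof -
  have "A ** V = (A ** Wmat \<alpha> x) ** (matrix_inv (Wmat \<alpha> x) ** V)" for A V x
  proof -
    have "(A ** Wmat \<alpha> x) ** (matrix_inv (Wmat \<alpha> x) ** V) = A ** (Wmat \<alpha> x ** matrix_inv (Wmat \<alpha> x)) ** V"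
      by (simp add: matrix_mul_assoc)
    then show ?thesis
      using assms by (simp add: matrix_inv_right Wmat_eq invertible_expW)
  qed
  note key = this
  show ?thesis
    unfolding Mtilde_minus_def Mtilde_plus_def by (simp only: key[symmetric])
qed

text \<open>The diagonal weights in \<open>Xlam\<close> are the projections that split
  \<open>Mtilde\<close> for \<open>Qmat\<close>; hence \<open>Xlam\<close> at l decides whether a
  nonzero \<mu> is an eigenvalue for \<open>Qmat\<close>.\<close>

lemma characteristic_matrix_Qmat:
  assumes "\<alpha> \<noteq> 0"
  shows "left_block (Qmat \<alpha>) ** Wlam \<alpha> k \<mu> (- l) + right_block (Qmat \<alpha>) ** Wlam \<alpha> k \<mu> l =
    Mtilde l \<alpha> (Qmat \<alpha>) ** Xlam \<alpha> k \<mu> l"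
  unfolding characteristic_matrix_eq[OF assms] Xlam_def
  by (simp add: matrix_add_ldistrib matrix_mul_assoc Mtilde_Qmat_proj)

text \<open>For \<open>Qmat\<close> the inverse of \<open>Mtilde\<close> times
  \<open>Mtilde_plus\<close> is \<open>proj14\<close>, and the factor \<open>Omega ** Lsq\<close> in
  \<open>G_plus\<close> cancels against its inverse in \<open>Gmat\<close>.\<close>

lemma Gmat_eq:
  assumes "\<alpha> \<noteq> 0"
  shows "Gmat l \<alpha> M = (matrix_inv (Mtilde l \<alpha> M) ** Mtilde_plus l \<alpha> M - proj14) ** Eps"
proof -
  let ?Q = "Qmat \<alpha>"
  have "matrix_inv (Mtilde l \<alpha> ?Q) ** Mtilde_plus l \<alpha> ?Q = proj14"
    unfolding Mtilde_Qmat_proj(2)[symmetric]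
    by (simp add: matrix_mul_assoc matrix_inv_left invertible_Mtilde_Qmat assms)
  then have "Gmat l \<alpha> M = (matrix_inv (Mtilde l \<alpha> M) ** Mtilde_plus l \<alpha> M - proj14) **
      ((Omega ** Lsq) ** matrix_inv (Omega ** Lsq)) ** Eps"
    by (simp add: Gmat_def G_plus_def matrix_diff_rdistrib matrix_mul_assoc)
  then show ?thesis
    by (simp add: matrix_inv_right[OF invertible_Omega_Lsq])
qed

text \<open>The right factor \<open>Xlam\<close> clears the inverse in \<open>Ylam\<close>, and the
  left factor \<open>Mtilde\<close> clears the one in \<open>Gmat\<close>.\<close>

lemma Gmat_Ylam_mult_Xlam:
  assumes M: "invertible (Mtilde l \<alpha> M)" and X: "invertible (Xlam \<alpha> k \<mu> l)" and \<alpha>: "\<alpha> \<noteq> 0"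
  shows "Mtilde l \<alpha> M ** ((Gmat l \<alpha> M ** Ylam l \<alpha> k \<mu> - mat 1) ** Xlam \<alpha> k \<mu> l) =
    - (left_block M ** Wlam \<alpha> k \<mu> (- l) + right_block M ** Wlam \<alpha> k \<mu> l)"
proof -
  define A where "A = matrix_inv (Wmat \<alpha> (- l)) ** Wlam \<alpha> k \<mu> (- l)"
  define B where "B = matrix_inv (Wmat \<alpha> l) ** Wlam \<alpha> k \<mu> l"
  define T where "T = matrix_inv (Mtilde l \<alpha> M) ** Mtilde_plus l \<alpha> M"
  have X_l: "Xlam \<alpha> k \<mu> l = proj23 ** A + proj14 ** B" and X_ml: "Xlam \<alpha> k \<mu> (- l) = proj23 ** B + proj14 ** A"
    by (simp_all add: Xlam_def A_def B_def matrix_mul_assoc)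
  have E2: "Eps ** Eps = mat 1"
    unfolding Eps_def by (simp add: vec_eq_iff diag_mult_nth forall_4) (simp add: diag_def mat_def)
  have "Ylam l \<alpha> k \<mu> ** Xlam \<alpha> k \<mu> l =
      Xlam \<alpha> k \<mu> (- l) ** (matrix_inv (Xlam \<alpha> k \<mu> l) ** Xlam \<alpha> k \<mu> l) - Xlam \<alpha> k \<mu> l"
    by (simp add: Ylam_def matrix_diff_rdistrib matrix_mul_assoc)
  also have "\<dots> = Xlam \<alpha> k \<mu> (- l) - Xlam \<alpha> k \<mu> l"
    by (simp add: matrix_inv_left[OF X])
  \<comment> \<open>Passing from l to -l swaps A and B in \<open>Xlam\<close>, and
    \<open>proj23 - proj14 = - Eps\<close>.\<close>
  also have "\<dots> = - (Eps ** (B - A))"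
    by (simp add: X_l X_ml vec_eq_iff diag_mult_nth Eps_def forall_4)
  finally have YX: "Ylam l \<alpha> k \<mu> ** Xlam \<alpha> k \<mu> l = - (Eps ** (B - A))" .
  have "(Gmat l \<alpha> M ** Ylam l \<alpha> k \<mu> - mat 1) ** Xlam \<alpha> k \<mu> l =
      Gmat l \<alpha> M ** (Ylam l \<alpha> k \<mu> ** Xlam \<alpha> k \<mu> l) - Xlam \<alpha> k \<mu> l"
    by (simp add: matrix_diff_rdistrib matrix_mul_assoc)
  also have "\<dots> = - ((T - proj14) ** (Eps ** Eps) ** (B - A)) - Xlam \<alpha> k \<mu> l"
    by (simp add: YX Gmat_eq[OF \<alpha>] matrix_minus_right matrix_mul_assoc T_def)
  also have "\<dots> = - (T ** (B - A)) + (proj14 ** (B - A) - Xlam \<alpha> k \<mu> l)"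
    by (simp add: E2 matrix_diff_rdistrib)
  \<comment> \<open>The B terms cancel, and \<open>proj14 + proj23 = mat 1\<close> collects the A
    terms.\<close>
  also have "proj14 ** (B - A) - Xlam \<alpha> k \<mu> l = - A"
    by (simp add: X_l vec_eq_iff diag_mult_nth forall_4)
  finally have *: "(Gmat l \<alpha> M ** Ylam l \<alpha> k \<mu> - mat 1) ** Xlam \<alpha> k \<mu> l = - (A + T ** (B - A))"
    by simp
  have "Mtilde l \<alpha> M ** T = Mtilde_plus l \<alpha> M"
    by (simp add: T_def matrix_mul_assoc matrix_inv_right[OF M])
  then have "Mtilde l \<alpha> M ** (A + T ** (B - A)) = Mtilde l \<alpha> M ** A + Mtilde_plus l \<alpha> M ** (B - A)"
    by (simp add: matrix_add_ldistrib matrix_mul_assoc)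
  also have "\<dots> = Mtilde_minus l \<alpha> M ** A + Mtilde_plus l \<alpha> M ** B"
    by (simp add: Mtilde_def matrix_add_rdistrib matrix_diff_ldistrib)
  finally show ?thesis
    unfolding * characteristic_matrix_eq[OF \<alpha>] A_def[symmetric] B_def[symmetric] matrix_minus_right
    by (simp only:)
qed

lemma det_minus_eq_0_iff:
  fixes A :: "complex ^ 'n ^ 'n"
  shows "det (- A) = 0 \<longleftrightarrow> det A = 0"
proof -
  have "(- A) *v v = - (A *v v)" for v
    by (simp add: vec_eq_iff matrix_vector_mult_def sum_negf)
  then show ?thesis
    by (simp add: det_eq_0_iff_kernel)
qed

theorem corollary2:
  fixes l \<alpha> k :: real and M :: "complex ^ 8 ^ 4" and \<mu> :: complex
  assumes "l > 0" and "\<alpha> > 0" and "k > 0"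
    and "M \<in> wp l \<alpha>"
    and "\<mu> \<notin> Spec l (K_op l \<alpha> k (Qmat \<alpha>))"
  shows "\<mu> \<in> Spec l (K_op l \<alpha> k M) \<longleftrightarrow>
           \<mu> \<noteq> 0 \<and> det (Gmat l \<alpha> M ** Ylam l \<alpha> k \<mu> - mat 1) = 0"
proof (cases "\<mu> = 0")
  case True
  then show ?thesis
    using zero_notin_Spec_K_op[OF wp_imp_invertible_Mtilde[OF assms(4,1,2)] assms(1-3)] by simp
next
  case False
  have \<alpha>: "\<alpha> \<noteq> 0"
    using assms(2) by simp
  have M: "invertible (Mtilde l \<alpha> M)"
    by (rule wp_imp_invertible_Mtilde[OF assms(4,1,2)])
  \<comment> \<open>The spectral criterion for \<open>Qmat\<close> turns the hypothesis on \<mu>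
    into invertibility of \<open>Xlam\<close> at l, which gives the inverse in \<open>Ylam\<close>
    its meaning.\<close>
  have "det (Mtilde l \<alpha> (Qmat \<alpha>) ** Xlam \<alpha> k \<mu> l) \<noteq> 0"
    using Spec_K_op_iff[OF invertible_Mtilde_Qmat[OF \<alpha>] assms(1-3) False] assms(5)
    unfolding characteristic_matrix_Qmat[OF \<alpha>] by blast
  then have detX: "det (Xlam \<alpha> k \<mu> l) \<noteq> 0"
    by (simp add: det_mul)
  then have X: "invertible (Xlam \<alpha> k \<mu> l)"
    by (simp add: invertible_det_nz)
  have "\<mu> \<in> Spec l (K_op l \<alpha> k M) \<longleftrightarrow>
      det (Mtilde l \<alpha> M ** ((Gmat l \<alpha> M ** Ylam l \<alpha> k \<mu> - mat 1) ** Xlam \<alpha> k \<mu> l)) = 0"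
    unfolding Spec_K_op_iff[OF M assms(1-3) False] Gmat_Ylam_mult_Xlam[OF M X \<alpha>] det_minus_eq_0_iff ..
  also have "\<dots> \<longleftrightarrow> det (Gmat l \<alpha> M ** Ylam l \<alpha> k \<mu> - mat 1) = 0"
    using M detX by (simp add: det_mul invertible_det_nz)
  finally show ?thesis
    using False by simp
qed

end
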